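(* Let $a,b$ be integers with $b>a\ge 2$. The simplex $T=T(a,b)$ is hyperbolic with vertices out of the absolute if and only if $$\left(1+\cos\frac{\pi}{a}\right)\sin\frac{2\pi}{b}>\left(\cos\frac{\pi}{a}+\cos\frac{2\pi}{b}\right)\sin\frac{\pi}{a}.$$
   Context: Let $a,b$ be positive integers. The simplex $T=T(a,b)$ with vertices $A_0,A_1,A_2,A_3$ has dihedral angles $\alpha_1,\alpha_2,\beta_1,\beta_2$ (each of $\alpha_1,\beta_1$ occurring at two edges, each of $\alpha_2,\beta_2$ at one edge) encoded by the Coxeter-Schläfli matrix (rows and columns indexed by $0,1,2,3$) $$\mathbb{B}=\begin{bmatrix}1&-\cos\beta_1&-\cos\beta_2&-\cos\alpha_1\\-\cos\beta_1&1&-\cos\alpha_1&-\cos\alpha_2\\-\cos\beta_2&-\cos\alpha_1&1&-\cos\beta_1\\-\cos\alpha_1&-\cos\alpha_2&-\cos\beta_1&1\end{bmatrix}.$$ The angles are required to satisfy the angle conditions $$2\alpha_1+\alpha_2=\frac{2\pi}{a},\qquad 2\beta_1+\beta_2=\frac{2\pi}{b},$$ and, because the face pairings of $T$ are isometries (so that $d(A_0,A_1)=d(A_0,A_2)$ and $d(A_0,A_3)=d(A_1,A_3)$), the edge conditions $f_1=0$, $f_2=0$, where $$f_1=B_{00}\sin^2\beta_1-B_{11}\sin^2\alpha_2,\qquad f_2=B_{11}\sin^2\alpha_1-B_{00}\sin^2\beta_2,$$ $$B_{00}=1-\cos^2\alpha_1-\cos^2\alpha_2-\cos^2\beta_1-2\cos\alpha_1\cos\alpha_2\cos\beta_1,$$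 $$B_{11}=1-\cos^2\alpha_1-\cos^2\beta_1-\cos^2\beta_2-2\cos\alpha_1\cos\beta_1\cos\beta_2.$$ A solution $(\alpha_1,\alpha_2,\beta_1,\beta_2)$ of the angle conditions and edge conditions is called proper if $\alpha_1,\alpha_2,\beta_1,\beta_2$ are all strictly positive and they are the dihedral angles of a hyperbolic simplex with all vertices out of the absolute, i.e. $\mathbb{B}$ has signature $(+,+,+,-)$ and, for each $i=0,1,2,3$, the $3\times3$ submatrix $\hat B_{ii}$ of $\mathbb{B}$ obtained by deleting the $i$-th row and $i$-th column has signature $(+,+,-)$. "$T(a,b)$ is hyperbolic with vertices out of the absolute" means that, for the given $a,b$, the system consisting of the angle conditions and the edge conditions has a proper solution, and that this proper solution is unique. *)

theory Defs
  imports Complex_Main "Jordan_Normal_Form.Determinant"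
begin

text \<open>Signature with \<open>p\<close> plus signs and \<open>q\<close> minus signs, in the sense of Sylvester: some basis
  (the columns of \<open>P\<close>) brings the quadratic form of \<open>A\<close> to a diagonal form with these signs.
  As the dimension is exactly \<open>p + q\<close>, the form is nondegenerate, and \<open>A\<close> is
  automatically symmetric.\<close>

definition has_signature :: "real mat \<Rightarrow> nat \<Rightarrow> nat \<Rightarrow> bool" where
  "has_signature A p q \<longleftrightarrow>
     A \<in> carrier_mat (p + q) (p + q) \<and>
     (\<exists>P \<in> carrier_mat (p + q) (p + q).
        invertible_mat P \<and>
        transpose_mat P * A * P = mat_diag (p + q) (\<lambda>i. if i < p then 1 else - 1))"

definition coxeter_schlaefli :: "real \<Rightarrow> real \<Rightarrow> real \<Rightarrow> real \<Rightarrow> real mat" where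
  "coxeter_schlaefli \<alpha>1 \<alpha>2 \<beta>1 \<beta>2 = mat_of_rows_list 4
     [[1, - cos \<beta>1, - cos \<beta>2, - cos \<alpha>1],
      [- cos \<beta>1, 1, - cos \<alpha>1, - cos \<alpha>2],
      [- cos \<beta>2, - cos \<alpha>1, 1, - cos \<beta>1],
      [- cos \<alpha>1, - cos \<alpha>2, - cos \<beta>1, 1]]"

definition angle_conditions :: "int \<Rightarrow> int \<Rightarrow> real \<Rightarrow> real \<Rightarrow> real \<Rightarrow> real \<Rightarrow> bool" where
  "angle_conditions a b \<alpha>1 \<alpha>2 \<beta>1 \<beta>2 \<longleftrightarrow>
     2 * \<alpha>1 + \<alpha>2 = 2 * pi / real_of_int a \<and>
     2 * \<beta>1 + \<beta>2 = 2 * pi / real_of_int b"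

definition B00 :: "real \<Rightarrow> real \<Rightarrow> real \<Rightarrow> real" where
  "B00 \<alpha>1 \<alpha>2 \<beta>1 =
     1 - (cos \<alpha>1)\<^sup>2 - (cos \<alpha>2)\<^sup>2 - (cos \<beta>1)\<^sup>2 - 2 * cos \<alpha>1 * cos \<alpha>2 * cos \<beta>1"

definition B11 :: "real \<Rightarrow> real \<Rightarrow> real \<Rightarrow> real" where
  "B11 \<alpha>1 \<beta>1 \<beta>2 =
     1 - (cos \<alpha>1)\<^sup>2 - (cos \<beta>1)\<^sup>2 - (cos \<beta>2)\<^sup>2 - 2 * cos \<alpha>1 * cos \<beta>1 * cos \<beta>2"

definition f1 :: "real \<Rightarrow> real \<Rightarrow> real \<Rightarrow> real \<Rightarrow> real" where
  "f1 \<alpha>1 \<alpha>2 \<beta>1 \<beta>2 = B00 \<alpha>1 \<alpha>2 \<beta>1 * (sin \<beta>1)\<^sup>2 - B11 \<alpha>1 \<beta>1 \<beta>2 * (sin \<alpha>2)\<^sup>2"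

definition f2 :: "real \<Rightarrow> real \<Rightarrow> real \<Rightarrow> real \<Rightarrow> real" where
  "f2 \<alpha>1 \<alpha>2 \<beta>1 \<beta>2 = B11 \<alpha>1 \<beta>1 \<beta>2 * (sin \<alpha>1)\<^sup>2 - B00 \<alpha>1 \<alpha>2 \<beta>1 * (sin \<beta>2)\<^sup>2"

definition edge_conditions :: "real \<Rightarrow> real \<Rightarrow> real \<Rightarrow> real \<Rightarrow> bool" where
  "edge_conditions \<alpha>1 \<alpha>2 \<beta>1 \<beta>2 \<longleftrightarrow> f1 \<alpha>1 \<alpha>2 \<beta>1 \<beta>2 = 0 \<and> f2 \<alpha>1 \<alpha>2 \<beta>1 \<beta>2 = 0"

definition proper :: "real \<Rightarrow> real \<Rightarrow> real \<Rightarrow> real \<Rightarrow> bool" where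
  "proper \<alpha>1 \<alpha>2 \<beta>1 \<beta>2 \<longleftrightarrow>
     \<alpha>1 > 0 \<and> \<alpha>2 > 0 \<and> \<beta>1 > 0 \<and> \<beta>2 > 0 \<and>
     has_signature (coxeter_schlaefli \<alpha>1 \<alpha>2 \<beta>1 \<beta>2) 3 1 \<and>
     (\<forall>i<4. has_signature (mat_delete (coxeter_schlaefli \<alpha>1 \<alpha>2 \<beta>1 \<beta>2) i i) 2 1)"

definition proper_solution :: "int \<Rightarrow> int \<Rightarrow> real \<Rightarrow> real \<Rightarrow> real \<Rightarrow> real \<Rightarrow> bool" where
  "proper_solution a b \<alpha>1 \<alpha>2 \<beta>1 \<beta>2 \<longleftrightarrow>
     angle_conditions a b \<alpha>1 \<alpha>2 \<beta>1 \<beta>2 \<and> edge_conditions \<alpha>1 \<alpha>2 \<beta>1 \<beta>2 \<and> proper \<alpha>1 \<alpha>2 \<beta>1 \<beta>2"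

text \<open>Existence and uniqueness refer to the quadruple of angles as a whole; nested \<open>\<exists>!\<close>
  quantifiers over the four angles would mean something else.\<close>

definition hyperbolic_vertices_out_of_absolute :: "int \<Rightarrow> int \<Rightarrow> bool" where
  "hyperbolic_vertices_out_of_absolute a b \<longleftrightarrow>
     (\<exists>!s. case s of (\<alpha>1, \<alpha>2, \<beta>1, \<beta>2) \<Rightarrow> proper_solution a b \<alpha>1 \<alpha>2 \<beta>1 \<beta>2)"

end

theory Submission
  imports Defs
begin

text \<open>Write \<open>h = \<pi>/a\<close>, \<open>k = \<pi>/b\<close>, \<open>\<alpha>2 = 2 p\<close>, \<open>\<beta>2 = 2 q\<close>, so that \<open>\<alpha>1 = h - p\<close> and \<open>\<beta>1 = k - q\<close>.
  For a proper solution all principal minors \<open>B00\<close>, \<open>B11\<close> are negative, and the two edge conditions give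
  \<open>sin \<alpha>1 sin \<beta>1 = sin \<alpha>2 sin \<beta>2\<close>. Given this, the remaining edge condition becomes the vanishing of a
  product of four factors; the signs of the two factors of \<open>det B\<close> exclude all of them but one, namely
  \<open>sin q sin (p + \<beta>1) = sin p sin (q + \<alpha>1)\<close>.

  In terms of \<open>N = q - p\<close> and \<open>M = p + q\<close> the last equation reads
  \<open>tan (M/2) tan ((h - k)/2 + N) = tan ((h + k)/2) tan (N/2)\<close>, so \<open>M\<close> is a function of \<open>N\<close>, and the first one becomes
  \<open>g N = 0\<close> with \<open>0 < N < min (h - k) k\<close>. The sign of \<open>g\<close> is that of a combination \<open>L\<close> of logarithms with positive
  derivative, so it has at most one zero; \<open>g\<close> is negative at \<open>0\<close>. At the right end of the interval \<open>g\<close> is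
  positive if \<open>h - k \<le> k\<close>, and otherwise \<open>g k\<close> has the sign of the difference of the two sides of the
  inequality. Conversely a zero of \<open>g\<close> satisfies \<open>3 M < h + k\<close>, from which the signature conditions follow.\<close>

section \<open>Signatures of the Coxeter-Schlaefli matrix and its minors\<close>

lemma invertible_mat_if_det_nonzero:
  fixes A :: "'a :: field mat"
  assumes "A \<in> carrier_mat n n" "det A \<noteq> 0"
  shows "invertible_mat A"
proof -
  from det_non_zero_imp_unit[OF assms, of "()"]
  obtain B where "B \<in> carrier_mat n n" "B * A = 1\<^sub>m n" "A * B = 1\<^sub>m n"
    unfolding Units_def ring_mat_def by auto
  then show ?thesis
    unfolding invertible_mat_def inverts_mat_def using assms(1) by auto
qed

lemma det_mat_diag:
  "det (mat_diag n f :: 'a :: comm_ring_1 mat) = (\<Prod>i<n. f i)"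
  by (subst det_upper_triangular[of _ n])
    (auto simp: mat_diag_def prod_list_diag_prod atLeast0LessThan intro!: prod.cong)

lemma prod_signs: "(\<Prod>i<p + q. if i < p then 1 else - 1 :: real) = (- 1) ^ q"
proof -
  have "(\<Prod>i<p + q. if i < p then 1 else - 1 :: real) = (\<Prod>i\<in>{p..<p + q}. - 1)"
    by (rule prod.mono_neutral_cong_right) auto
  then show ?thesis by simp
qed

lemma det_congruent:
  fixes A P :: "'a :: comm_ring_1 mat"
  assumes "A \<in> carrier_mat n n" "P \<in> carrier_mat n n"
  shows "det (transpose_mat P * A * P) = (det P)\<^sup>2 * det A"
  using assms by (simp add: det_mult[of _ n] det_transpose[OF assms(2)] power2_eq_square)

text \<open>Congruence multiplies the determinant by a square, so its sign is an invariant of the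
  form. This sign is all that is ever extracted from a signature hypothesis.\<close>

lemma has_signature_det:
  assumes "has_signature A p q"
  shows "(- 1) ^ q * det A > 0"
proof -
  from assms obtain P where "(det P)\<^sup>2 * det A = (- 1) ^ q"
    unfolding has_signature_def by (metis det_congruent det_mat_diag prod_signs)
  then have "(det P)\<^sup>2 * ((- 1) ^ q * det A) = 1"
    by (simp add: mult.left_commute flip: power_mult_distrib)
  then show ?thesis
    by (metis mult_nonneg_nonpos not_less zero_le_power2 not_one_le_zero)
qed

text \<open>Invertibility of \<open>P\<close> comes for free: the diagonal matrix has determinant
  \<open>(- 1) ^ q\<close>, which forces \<open>det P\<close> to be nonzero.\<close>

lemma has_signatureI:
  assumes A: "A \<in> carrier_mat (p + q) (p + q)" and P: "P \<in> carrier_mat (p + q) (p + q)"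
    and eq: "transpose_mat P * A * P = mat_diag (p + q) (\<lambda>i. if i < p then 1 else - 1)"
  shows "has_signature A p q"
proof -
  have "(det P)\<^sup>2 * det A = (- 1) ^ q"
    using det_congruent[OF A P] by (simp add: eq det_mat_diag prod_signs)
  then have "det P \<noteq> 0" by auto
  then show ?thesis
    unfolding has_signature_def using A P eq invertible_mat_if_det_nonzero by blast
qed

text \<open>Laplace expansion in which the minors are again \<open>mat n n\<close> of an explicit
  entry function, so that rewriting can iterate it on concrete matrices down to size 0.\<close>

lemma det_mat_Suc:
  "det (mat (Suc n) (Suc n) f :: 'a :: comm_ring_1 mat) =
    (\<Sum>i<Suc n. f (i, 0) * ((- 1) ^ i *
       det (mat n n (\<lambda>(r, c). f (if r < i then r else Suc r, Suc c)))))"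
proof -
  have "det (mat (Suc n) (Suc n) f) =
      (\<Sum>i<Suc n. mat (Suc n) (Suc n) f $$ (i, 0) * cofactor (mat (Suc n) (Suc n) f) i 0)"
    by (rule laplace_expansion_column) auto
  also have "\<dots> = (\<Sum>i<Suc n. f (i, 0) * ((- 1) ^ i *
       det (mat n n (\<lambda>(r, c). f (if r < i then r else Suc r, Suc c)))))"
  proof (rule sum.cong)
    fix i assume "i \<in> {..<Suc n}"
    then have "mat_delete (mat (Suc n) (Suc n) f) i 0
        = mat n n (\<lambda>(r, c). f (if r < i then r else Suc r, Suc c))"
      by (intro eq_matI) (auto simp: mat_delete_def)
    then show "mat (Suc n) (Suc n) f $$ (i, 0) * cofactor (mat (Suc n) (Suc n) f) i 0
        = f (i, 0) * ((- 1) ^ i * det (mat n n (\<lambda>(r, c). f (if r < i then r else Suc r, Suc c))))"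
      using \<open>i \<in> {..<Suc n}\<close> by (simp add: cofactor_def)
  qed simp
  finally show ?thesis .
qed

lemma less_3_cases: "(i::nat) < 3 \<longleftrightarrow> i = 0 \<or> i = 1 \<or> i = 2"
  by auto

lemma det_mat_of_rows_list_3:
  "det (mat_of_rows_list 3 [[a,b,c],[d,e,f],[g,h,i]] :: real mat)
    = a * (e * i - f * h) - b * (d * i - f * g) + c * (d * h - e * g)"
  by (simp add: mat_of_rows_list_def numeral_3_eq_3 det_mat_Suc algebra_simps)

section \<open>Symmetric matrices with unit diagonal: determinants and explicit
  diagonalisation\<close>

definition sym3 :: "real \<Rightarrow> real \<Rightarrow> real \<Rightarrow> real mat" where
  "sym3 a b c = mat_of_rows_list 3 [[1,a,b],[a,1,c],[b,c,1]]"

definition sym4 :: "real \<Rightarrow> real \<Rightarrow> real \<Rightarrow> real \<Rightarrow> real \<Rightarrow> real \<Rightarrow> real mat" where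
  "sym4 a b c d e f = mat_of_rows_list 4 [[1,a,b,c],[a,1,d,e],[b,d,1,f],[c,e,f,1]]"

lemma det_sym3: "det (sym3 a b c) = 1 - a\<^sup>2 - b\<^sup>2 - c\<^sup>2 + 2 * a * b * c"
  by (simp add: sym3_def det_mat_of_rows_list_3 algebra_simps power2_eq_square)

lemma det_sym4: "det (sym4 a b c d e f) = 1 - a\<^sup>2 - b\<^sup>2 - c\<^sup>2 - d\<^sup>2 - e\<^sup>2 - f\<^sup>2
    + 2 * a * b * d + 2 * a * c * e + 2 * b * c * f + 2 * d * e * f
    + a\<^sup>2 * f\<^sup>2 + b\<^sup>2 * e\<^sup>2 + c\<^sup>2 * d\<^sup>2 - 2 * a * b * e * f - 2 * a * c * d * f - 2 * b * c * d * e"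
  by (simp add: sym4_def mat_of_rows_list_def eval_nat_numeral det_mat_Suc algebra_simps)

text \<open>Dividing column \<open>i\<close> of \<open>W\<close> by
  \<open>sqrt \<bar>d i\<bar>\<close> turns the diagonal entries into their signs. The congruence
  matrices below can therefore have polynomial entries.\<close>

lemma has_signature_if_diagonalizable:
  assumes A: "A \<in> carrier_mat (p + q) (p + q)" and W: "W \<in> carrier_mat (p + q) (p + q)"
    and eq: "transpose_mat W * A * W = mat_diag (p + q) d"
    and pos: "\<And>i. i < p \<Longrightarrow> d i > 0" and neg: "\<And>i. p \<le> i \<Longrightarrow> i < p + q \<Longrightarrow> d i < 0"
  shows "has_signature A p q"
proof (rule has_signatureI[OF A])
  let ?n = "p + q"
  define S where "S = mat_diag ?n (\<lambda>i. 1 / sqrt \<bar>d i\<bar>)"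
  have S: "S \<in> carrier_mat ?n ?n" and ST: "transpose_mat S = S"
    by (auto simp: S_def mat_diag_def intro!: eq_matI)
  show "W * S \<in> carrier_mat ?n ?n" using W S by simp
  have "transpose_mat (W * S) * A * (W * S) = S * (transpose_mat W * A * W) * S"
    using A W S by (simp add: transpose_mult[OF W S] ST assoc_mult_mat[of _ ?n ?n _ ?n _ ?n])
  also have "\<dots> = mat_diag ?n (\<lambda>i. 1 / sqrt \<bar>d i\<bar> * d i * (1 / sqrt \<bar>d i\<bar>))"
    by (simp add: eq S_def)
  also have "\<dots> = mat_diag ?n (\<lambda>i. if i < p then 1 else - 1)"
  proof (rule eq_matI)
    fix i j assume "i < dim_row (mat_diag ?n (\<lambda>i. if i < p then 1 else - 1 :: real))"
      "j < dim_col (mat_diag ?n (\<lambda>i. if i < p then 1 else - 1 :: real))"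
    then show "mat_diag ?n (\<lambda>i. 1 / sqrt \<bar>d i\<bar> * d i * (1 / sqrt \<bar>d i\<bar>)) $$ (i, j)
        = mat_diag ?n (\<lambda>i. if i < p then 1 else - 1) $$ (i, j)"
      using pos[of j] neg[of j] by (auto simp: mat_diag_def)
  qed (auto simp: mat_diag_def)
  finally show "transpose_mat (W * S) * A * (W * S) = mat_diag ?n (\<lambda>i. if i < p then 1 else - 1)" .
qed

lemma sym3_signature:
  assumes "a\<^sup>2 < 1" "det (sym3 a b c) < 0"
  shows "has_signature (sym3 a b c) 2 1"
proof -
  \<comment> \<open>The second column is a Gram-Schmidt step. The third is the last column of the
    adjugate, which the matrix sends to \<open>D3\<close> times a unit vector, hence it is
    orthogonal to the other two.\<close>
  define W where "W = mat_of_rows_list 3 [[1, - a, a * c - b], [0, 1, a * b - c], [0, 0, 1 - a\<^sup>2]]"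
  define D3 where "D3 = det (sym3 a b c)"
  have D3: "D3 = 1 - a\<^sup>2 - b\<^sup>2 - c\<^sup>2 + 2 * a * b * c"
    by (simp add: D3_def det_sym3)
  define d where "d i = [1, 1 - a\<^sup>2, (1 - a\<^sup>2) * D3] ! i" for i
  show ?thesis
  proof (rule has_signature_if_diagonalizable[of _ _ _ W d])
    show "transpose_mat W * sym3 a b c * W = mat_diag (2 + 1) d"
      by (rule eq_matI)
        (auto simp: W_def d_def D3 sym3_def mat_of_rows_list_def mat_diag_def scalar_prod_def
          power2_eq_square numeral_2_eq_2 numeral_3_eq_3 less_Suc_eq algebra_simps)
    show "d i > 0" if "i < 2" for i
      using that assms by (auto simp: d_def less_2_cases_iff)
    show "d i < 0" if "2 \<le> i" "i < 2 + 1" for i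
    proof -
      have "i = 2" using that by simp
      then show ?thesis using assms by (simp add: d_def D3_def mult_pos_neg)
    qed
  qed (auto simp: W_def sym3_def mat_of_rows_list_def)
qed

lemma sym4_signature:
  assumes "a\<^sup>2 < 1" "det (sym3 a b d) < 0" "det (sym4 a b c d e f) < 0"
  shows "has_signature (sym4 a b c d e f) 3 1"
proof -
  \<comment> \<open>\<open>(w0, w1, w2, D3)\<close> is the last column of the adjugate.\<close>
  define w0 w1 w2 where
    "w0 = - c + c * d\<^sup>2 + a * e + b * f - a * d * f - b * d * e" and
    "w1 = - e + b\<^sup>2 * e + a * c + d * f - a * b * f - b * c * d" and
    "w2 = - f + a\<^sup>2 * f + b * c + d * e - a * b * e - a * c * d"
  note w_defs = w0_def w1_def w2_def
  define D3 D4 where "D3 = det (sym3 a b d)" and "D4 = det (sym4 a b c d e f)"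
  have ker: "w0 + a * w1 + b * w2 + c * D3 = 0" "a * w0 + w1 + d * w2 + e * D3 = 0"
    "b * w0 + d * w1 + w2 + f * D3 = 0" "c * w0 + e * w1 + f * w2 + D3 = D4"
    by (simp_all add: D3_def D4_def det_sym3 det_sym4 w_defs algebra_simps power2_eq_square)
  have "w1 + d * w2 + e * D3 = a * (a * w1 + b * w2 + c * D3)"
    using ker(2) arg_cong[OF ker(1), of "\<lambda>t. a * t"] by (simp add: algebra_simps)
  moreover have "D3 * w2 = D3 * (- f + a\<^sup>2 * f + b * c + d * e - a * b * e - a * c * d)"
    by (simp add: w2_def)
  ultimately have ker': "w1 + d * w2 + e * D3 = a * (a * w1 + b * w2 + c * D3)"
    "D3 * w2 = D3 * (- f + a * a * f + b * c + d * e - a * b * e - a * c * d)"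
    by (simp_all add: power2_eq_square)
  \<comment> \<open>The third column is the adjugate column of the whole matrix, the fourth that of
    the leading 3x3 block. In this order the negative sign comes last: \<open>D3 * D4 > 0\<close>,
    while \<open>(1 - a\<^sup>2) * D3 < 0\<close>.\<close>
  define W where "W = mat_of_rows_list 4 
    [[1, - a, w0, a * d - b], [0, 1, w1, a * b - d], [0, 0, w2, 1 - a\<^sup>2], [0, 0, D3, 0]]"
  define r where "r i = [1, 1 - a\<^sup>2, D3 * D4, (1 - a\<^sup>2) * D3] ! i" for i
  have W: "W \<in> carrier_mat 4 4" and A: "sym4 a b c d e f \<in> carrier_mat 4 4" for a b c d e f
    by (auto simp: W_def sym4_def mat_of_rows_list_def)
  have D3: "D3 = 1 - a\<^sup>2 - b\<^sup>2 - d\<^sup>2 + 2 * a * b * d"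
    by (simp add: D3_def det_sym3)
  \<comment> \<open>Multiplying on the right first collapses the adjugate column to
    \<open>D4\<close> times a unit vector.\<close>
  have AW: "sym4 a b c d e f * W = mat_of_rows_list 4 
    [[1, 0, 0, 0], [a, 1 - a\<^sup>2, 0, 0], [b, d - a * b, 0, D3], [c, e - a * c, D4, c * (a * d - b) + e * (a * b - d) + f * (1 - a\<^sup>2)]]"
    using ker by (intro eq_matI)
      (auto simp: W_def sym4_def mat_of_rows_list_def scalar_prod_def D3 power2_eq_square
          eval_nat_numeral less_Suc_eq algebra_simps)
  show ?thesis
  proof (rule has_signature_if_diagonalizable[of _ _ _ W r])
    have "transpose_mat W * sym4 a b c d e f * W = transpose_mat W * (sym4 a b c d e f * W)"
      using W A by (simp add: assoc_mult_mat[of _ 4 4 _ 4 _ 4])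
    also have "\<dots> = mat_diag (3 + 1) r"
      unfolding AW using ker ker'
      by (intro eq_matI) (auto simp: W_def mat_diag_def r_def mat_of_rows_list_def scalar_prod_def
          eval_nat_numeral less_Suc_eq algebra_simps)
    finally show "transpose_mat W * sym4 a b c d e f * W = mat_diag (3 + 1) r" .
    show "r i > 0" if "i < 3" for i
      using that assms by (auto simp: r_def D3_def D4_def less_3_cases mult_neg_neg)
    show "r i < 0" if "3 \<le> i" "i < 3 + 1" for i
    proof -
      have "i = 3" using that by simp
      then show ?thesis using assms by (simp add: r_def D3_def mult_pos_neg)
    qed
  qed (use W A in auto)
qed

section \<open>Proper angles expressed by signs of determinants\<close>

lemma coxeter_schlaefli_sym4:
  "coxeter_schlaefli \<alpha>1 \<alpha>2 \<beta>1 \<beta>2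
    = sym4 (- cos \<beta>1) (- cos \<beta>2) (- cos \<alpha>1) (- cos \<alpha>1) (- cos \<alpha>2) (- cos \<beta>1)"
  by (simp add: coxeter_schlaefli_def sym4_def)

lemma mat_delete_sym4:
  "mat_delete (sym4 a b c d e f) 0 0 = sym3 d e f"
  "mat_delete (sym4 a b c d e f) 1 1 = sym3 b c f"
  "mat_delete (sym4 a b c d e f) 2 2 = sym3 a c e"
  "mat_delete (sym4 a b c d e f) 3 3 = sym3 a b d"
  by (rule eq_matI; auto simp: mat_delete_def sym4_def sym3_def mat_of_rows_list_def
      eval_nat_numeral less_Suc_eq)+

text \<open>The matrix is invariant under the index permutation (0 2)(1 3), so it splits into 2x2
  blocks on the symmetric and the antisymmetric vectors; the factors are the block determinants. The
  same symmetry makes the four principal minors agree in pairs.\<close>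

lemma det_coxeter_schlaefli:
  "det (coxeter_schlaefli \<alpha>1 \<alpha>2 \<beta>1 \<beta>2)
    = ((1 - cos \<alpha>2) * (1 - cos \<beta>2) - (cos \<alpha>1 + cos \<beta>1)\<^sup>2)
      * ((1 + cos \<alpha>2) * (1 + cos \<beta>2) - (cos \<alpha>1 - cos \<beta>1)\<^sup>2)"
  by (simp add: coxeter_schlaefli_sym4 det_sym4 algebra_simps power2_eq_square)

lemma det_principal_minors:
  "det (sym3 (- cos \<alpha>1) (- cos \<alpha>2) (- cos \<beta>1)) = B00 \<alpha>1 \<alpha>2 \<beta>1"
  "det (sym3 (- cos \<beta>2) (- cos \<alpha>1) (- cos \<beta>1)) = B11 \<alpha>1 \<beta>1 \<beta>2"
  "det (sym3 (- cos \<beta>1) (- cos \<alpha>1) (- cos \<alpha>2)) = B00 \<alpha>1 \<alpha>2 \<beta>1"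
  "det (sym3 (- cos \<beta>1) (- cos \<beta>2) (- cos \<alpha>1)) = B11 \<alpha>1 \<beta>1 \<beta>2"
  by (simp_all add: det_sym3 B00_def B11_def algebra_simps)

lemma proper_imp_minors_neg:
  assumes "proper \<alpha>1 \<alpha>2 \<beta>1 \<beta>2"
  shows "B00 \<alpha>1 \<alpha>2 \<beta>1 < 0" "B11 \<alpha>1 \<beta>1 \<beta>2 < 0" "det (coxeter_schlaefli \<alpha>1 \<alpha>2 \<beta>1 \<beta>2) < 0"
proof -
  have *: "det (mat_delete (coxeter_schlaefli \<alpha>1 \<alpha>2 \<beta>1 \<beta>2) i i) < 0" if "i < 4" for i
    using assms that has_signature_det[of _ 2 1] by (auto simp: proper_def)
  show "B00 \<alpha>1 \<alpha>2 \<beta>1 < 0"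
    using *[of 0] by (simp add: coxeter_schlaefli_sym4 mat_delete_sym4 det_principal_minors)
  show "B11 \<alpha>1 \<beta>1 \<beta>2 < 0"
    using *[of 3] by (simp add: coxeter_schlaefli_sym4 mat_delete_sym4 det_principal_minors(4))
  show "det (coxeter_schlaefli \<alpha>1 \<alpha>2 \<beta>1 \<beta>2) < 0"
    using assms has_signature_det[of _ 3 1] by (auto simp: proper_def)
qed

text \<open>The leading minors of sizes 1 and 2 are positive for these angles, so the signs of the
  larger determinants already fix every signature.\<close>

lemma properI:
  assumes "\<alpha>1 > 0" "\<alpha>2 > 0" "\<beta>1 > 0" "\<beta>2 > 0" "\<alpha>1 < pi" "\<beta>1 < pi" "\<beta>2 < pi"
    and "B00 \<alpha>1 \<alpha>2 \<beta>1 < 0" "B11 \<alpha>1 \<beta>1 \<beta>2 < 0" "det (coxeter_schlaefli \<alpha>1 \<alpha>2 \<beta>1 \<beta>2) < 0"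
  shows "proper \<alpha>1 \<alpha>2 \<beta>1 \<beta>2"
proof -
  have cos_sq: "(cos t)\<^sup>2 < 1" if "0 < t" "t < pi" for t :: real
    using sin_gt_zero[OF that] sin_cos_squared_add[of t] by (metis less_add_same_cancel2 zero_less_power)
  note minors = assms(8)[folded det_principal_minors(1)] assms(9)[folded det_principal_minors(2)]
    assms(8)[folded det_principal_minors(3)] assms(9)[folded det_principal_minors(4)]
  have "has_signature (coxeter_schlaefli \<alpha>1 \<alpha>2 \<beta>1 \<beta>2) 3 1"
    unfolding coxeter_schlaefli_sym4
    by (rule sym4_signature) (use assms minors cos_sq in \<open>auto simp: coxeter_schlaefli_sym4\<close>)
  moreover have "has_signature (mat_delete (coxeter_schlaefli \<alpha>1 \<alpha>2 \<beta>1 \<beta>2) i i) 2 1" if "i < 4" for i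
  proof -
    have "i = 0 \<or> i = 1 \<or> i = 2 \<or> i = 3" using that by auto
    then show ?thesis
      unfolding coxeter_schlaefli_sym4
      by (elim disjE; simp only: mat_delete_sym4; intro sym3_signature)
        (use assms minors cos_sq in auto)
  qed
  ultimately show ?thesis using assms by (simp add: proper_def)
qed

section \<open>The edge conditions\<close>

text \<open>Here \<open>x\<close>, \<open>y\<close>, \<open>G\<close>, \<open>H\<close> are the
  cosines of \<alpha>1, \<beta>1, \<alpha>2, \<beta>2 and \<open>r\<close> is the square of
  \<open>sin \<beta>1 / sin \<alpha>2\<close>; the hypotheses encode the product relation. The last
  factor on the right is \<open>B11 - r * B00\<close>, which vanishes by the first edge condition,
  while the left side is a product of two differences of squares, hence of four linear factors when
  \<open>r\<close> is a square.\<close>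

lemma quartic_identity:
  fixes r x y G H :: real
  assumes "1 - y\<^sup>2 = r * (1 - G\<^sup>2)" "r * (1 - x\<^sup>2) = 1 - H\<^sup>2"
  shows "((r * (1 + G) - (1 + H))\<^sup>2 - r * (x - y)\<^sup>2) * ((r * (1 - G) - (1 - H))\<^sup>2 - r * (x + y)\<^sup>2)
    = - 4 * r * (r - 1) * ((1 - x\<^sup>2 - y\<^sup>2 - H\<^sup>2 - 2 * x * y * H) - r * (1 - x\<^sup>2 - G\<^sup>2 - y\<^sup>2 - 2 * x * G * y))"
proof -
  \<comment> \<open>The left side is a polynomial in \<open>U * V\<close>, \<open>U + V\<close> and
    \<open>U - V\<close>, each of which is much simpler than \<open>U\<close> and
    \<open>V\<close>.\<close>
  define U V where "U = r * (1 + G) - (1 + H)" and "V = r * (1 - G) - (1 - H)"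
  have sum: "U + V = 2 * (r - 1)" and diff: "U - V = 2 * (r * G - H)"
    by (simp_all add: U_def V_def algebra_simps)
  have "U * V = r * (r * (1 - G\<^sup>2)) + (1 - H\<^sup>2) - r * (2 - 2 * G * H)"
    by (simp add: U_def V_def algebra_simps power2_eq_square)
  then have prod: "U * V = r * (2 * G * H - x\<^sup>2 - y\<^sup>2)"
    unfolding assms[symmetric] by (simp add: algebra_simps)
  have "r * x\<^sup>2 = r - 1 + H\<^sup>2" "y\<^sup>2 = 1 - r + r * G\<^sup>2"
    using assms by (simp_all add: algebra_simps)
  then have xy: "r * (x * y)\<^sup>2 = (r - 1 + H\<^sup>2) * (1 - r + r * G\<^sup>2)"
    by (simp only: power_mult_distrib mult.assoc[symmetric])
  have "(U\<^sup>2 - r * (x - y)\<^sup>2) * (V\<^sup>2 - r * (x + y)\<^sup>2)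
    = (U * V)\<^sup>2 - r * (((U + V)\<^sup>2 - 2 * (U * V)) * (x\<^sup>2 + y\<^sup>2) + 2 * (x * y) * ((U + V) * (U - V)))
      + r * (r * (x\<^sup>2 + y\<^sup>2)\<^sup>2 - 4 * (r * (x * y)\<^sup>2))"
    by (simp add: algebra_simps power2_eq_square)
  also have "\<dots> = - 4 * r * (r - 1) * ((1 - x\<^sup>2 - y\<^sup>2 - H\<^sup>2 - 2 * x * y * H) - r * (1 - x\<^sup>2 - G\<^sup>2 - y\<^sup>2 - 2 * x * G * y))"
    unfolding sum diff prod xy by (simp add: algebra_simps power2_eq_square)
  finally show ?thesis unfolding U_def V_def .
qed

text \<open>The coefficients are the two factors of the Coxeter-Schlaefli determinant, the first
  with reversed sign. When the edge condition kills the right side, their signs force the quantities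
  \<open>U\<close> and \<open>V\<close> of the quartic identity to have equal signs.\<close>

lemma linear_identity:
  fixes r x y G H :: real
  shows "((x + y)\<^sup>2 - (1 - G) * (1 - H)) * (r * (1 + G) - (1 + H))
    - ((1 + G) * (1 + H) - (x - y)\<^sup>2) * (r * (1 - G) - (1 - H))
    = 2 * ((1 - x\<^sup>2 - y\<^sup>2 - H\<^sup>2 - 2 * x * y * H) - r * (1 - x\<^sup>2 - G\<^sup>2 - y\<^sup>2 - 2 * x * G * y))"
  by (simp add: algebra_simps power2_eq_square)

lemma sin_add_times_sin_diff: "sin (x + y) * sin (x - y) = (sin x)\<^sup>2 - (sin y)\<^sup>2" for x y :: real
proof -
  have "sin (x + y) * sin (x - y) = (sin x)\<^sup>2 * (cos y)\<^sup>2 - (cos x)\<^sup>2 * (sin y)\<^sup>2"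
    by (simp add: sin_add sin_diff algebra_simps power2_eq_square)
  then show ?thesis by (simp add: cos_squared_eq algebra_simps)
qed

text \<open>Multiplying the two edge conditions crosswise produces the nonzero common factor
  \<open>B00 * B11\<close>; cancelling it leaves an equation between squares of positive
  numbers.\<close>

lemma sine_product_of_edge_conditions:
  assumes "edge_conditions \<alpha>1 \<alpha>2 \<beta>1 \<beta>2" "B00 \<alpha>1 \<alpha>2 \<beta>1 < 0" "B11 \<alpha>1 \<beta>1 \<beta>2 < 0"
    and "sin \<alpha>1 > 0" "sin \<alpha>2 > 0" "sin \<beta>1 > 0" "sin \<beta>2 > 0"
  shows "sin \<alpha>1 * sin \<beta>1 = sin \<alpha>2 * sin \<beta>2"
proof -
  let ?X = "B00 \<alpha>1 \<alpha>2 \<beta>1" and ?Y = "B11 \<alpha>1 \<beta>1 \<beta>2"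
  have 1: "?X * (sin \<beta>1)\<^sup>2 = ?Y * (sin \<alpha>2)\<^sup>2" and 2: "?Y * (sin \<alpha>1)\<^sup>2 = ?X * (sin \<beta>2)\<^sup>2"
    using assms(1) by (auto simp: edge_conditions_def f1_def f2_def)
  have "(?X * ?Y) * (sin \<alpha>1 * sin \<beta>1)\<^sup>2 = (?X * (sin \<beta>1)\<^sup>2) * (?Y * (sin \<alpha>1)\<^sup>2)"
    by (simp add: power_mult_distrib)
  also have "\<dots> = (?X * ?Y) * (sin \<alpha>2 * sin \<beta>2)\<^sup>2"
    unfolding 1 2 by (simp add: power_mult_distrib)
  finally have "(sin \<alpha>1 * sin \<beta>1)\<^sup>2 = (sin \<alpha>2 * sin \<beta>2)\<^sup>2"
    using assms(2,3) by simp
  then show ?thesis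
    by (rule power2_eq_imp_eq) (use assms(4-) in auto)
qed

text \<open>The factors to be excluded correspond to \<open>V = \<plusminus>\<rho>(x + y)\<close> in the locale below; each is one of the two
  instances of this lemma under exchange of the roles of \<open>(a, x, q)\<close> and \<open>(b, y, p)\<close>.\<close>

lemma spurious_factor:
  fixes a b x y sp cp sq cq :: real
  assumes pos: "a > 0" "b > 0" "x > 0" "y > 0" "sp > 0" "cp > 0" "sq > 0" "cq > 0"
    and sc: "x\<^sup>2 + a\<^sup>2 = 1" "y\<^sup>2 + b\<^sup>2 = 1" "sp\<^sup>2 + cp\<^sup>2 = 1" "sq\<^sup>2 + cq\<^sup>2 = 1"
    and ab: "a * b = 4 * sp * cp * sq * cq"
    and eq: "b * (sp / cp) - a * (sq / cq) = x + y"
  shows "(x * cq < a * sq \<and> y * cp < b * sp) \<or>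
    (b = 2 * sp * cp \<and> 2 * (cp\<^sup>2 - cq\<^sup>2) = - (x + y))"
proof -
  \<comment> \<open>In angles, \<open>u = sin \<alpha>1 tan q\<close> and
    \<open>v = sin \<beta>1 tan p\<close>. With them the half-angle quantities can be eliminated,
    leaving a polynomial relation between \<open>x\<close>, \<open>y\<close>, \<open>u\<close>,
    \<open>v\<close>.\<close>
  define u v where "u = a * (sq / cq)" and "v = b * (sp / cp)"
  have u: "u * cq = a * sq" and v: "v * cp = b * sp" and uv_pos: "u > 0" "v > 0"
    using pos by (auto simp: u_def v_def)
  define C where "C = x + u"
  have C: "C = v - y" and "C > 0"
    using eq[folded u_def v_def] pos(3) uv_pos by (auto simp: C_def)
  have u2: "(1 - x\<^sup>2 + u\<^sup>2) * cq\<^sup>2 = a\<^sup>2" and v2: "(1 - y\<^sup>2 + v\<^sup>2) * cp\<^sup>2 = b\<^sup>2"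
  proof -
    have *: "(1 - c\<^sup>2 + w\<^sup>2) * t\<^sup>2 = e\<^sup>2"
      if "c\<^sup>2 + e\<^sup>2 = 1" "s\<^sup>2 + t\<^sup>2 = 1" "w * t = e * s" for c e s t w :: real
    proof -
      have e: "1 - c\<^sup>2 = e\<^sup>2" using that by simp
      have "(1 - c\<^sup>2 + w\<^sup>2) * t\<^sup>2 = e\<^sup>2 * t\<^sup>2 + (w * t)\<^sup>2"
        unfolding e by (simp add: algebra_simps)
      also have "\<dots> = e\<^sup>2 * (s\<^sup>2 + t\<^sup>2)"
        unfolding that(3) by (simp add: algebra_simps)
      finally show ?thesis using that by simp
    qed
    show "(1 - x\<^sup>2 + u\<^sup>2) * cq\<^sup>2 = a\<^sup>2" "(1 - y\<^sup>2 + v\<^sup>2) * cp\<^sup>2 = b\<^sup>2"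
      using *[OF sc(1) sc(4) u] *[OF sc(2) sc(3) v] by auto
  qed
  have "(4 * (u * v) - (1 - x\<^sup>2 + u\<^sup>2) * (1 - y\<^sup>2 + v\<^sup>2)) * (cp\<^sup>2 * cq\<^sup>2)
      = 4 * (u * cq) * (v * cp) * cp * cq - ((1 - x\<^sup>2 + u\<^sup>2) * cq\<^sup>2) * ((1 - y\<^sup>2 + v\<^sup>2) * cp\<^sup>2)"
    by (simp add: algebra_simps power2_eq_square)
  also have "\<dots> = (a * b) * (4 * sp * cp * sq * cq - a * b)"
    unfolding u v u2 v2 by (simp add: algebra_simps power2_eq_square)
  also have "\<dots> = 0" using ab by simp
  finally have "4 * (u * v) = (1 - x\<^sup>2 + u\<^sup>2) * (1 - y\<^sup>2 + v\<^sup>2)"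
    using pos by simp
  moreover have vx: "v = C + y" "x = C - u" using C C_def by auto
  \<comment> \<open>Through \<open>C = x + u = v - y\<close> the eliminated relation factors. The
    first factor leads to \<open>x < u\<close>, \<open>y < v\<close>, that is, to the first
    alternative; \<open>C = 1\<close> leads to the second.\<close>
  have "(1 + (x - u) * (y + v)) * (C\<^sup>2 - 1)
      = 4 * (u * v) - (1 - x\<^sup>2 + u\<^sup>2) * (1 - y\<^sup>2 + v\<^sup>2)"
    unfolding vx by (simp add: algebra_simps power2_eq_square)
  ultimately have "(1 + (x - u) * (y + v)) * (C\<^sup>2 - 1) = 0" by simp
  then have "1 + (x - u) * (y + v) = 0 \<or> C\<^sup>2 - 1 = 0" unfolding mult_eq_0_iff .
  then consider "1 + (x - u) * (y + v) = 0" | "C\<^sup>2 = 1" by (elim disjE) simp_all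
  then show ?thesis
  proof cases
    case 1
    have "x < u"
    proof (rule ccontr)
      assume "\<not> x < u"
      then have "(x - u) * (y + v) \<ge> 0" using pos uv_pos by simp
      then show False using 1 by simp
    qed
    moreover have "y < v" using C \<open>C > 0\<close> by simp
    ultimately show ?thesis using u v pos by (metis mult_strict_right_mono)
  next
    case 2
    then have "C = 1" using \<open>C > 0\<close> by (simp add: power2_eq_1_iff)
    then have uv: "u = 1 - x" "v = 1 + y" using C C_def by auto
    have "2 * sp\<^sup>2 = 1 + y"
    proof -
      have "1 - y\<^sup>2 + v\<^sup>2 = (1 + y) * 2"
        unfolding uv(2) by (simp add: algebra_simps power2_eq_square)
      then have "(1 + y) * (2 * cp\<^sup>2) = b\<^sup>2" unfolding v2[symmetric] by (simp only: mult.assoc)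
      moreover have "(1 + y) * (1 - y) = b\<^sup>2" using sc(2) by (simp add: algebra_simps power2_eq_square)
      ultimately have "(1 + y) * (2 * cp\<^sup>2) = (1 + y) * (1 - y)" by simp
      then have "2 * cp\<^sup>2 = 1 - y" using pos by simp
      then show ?thesis using sc by simp
    qed
    have "2 * cp\<^sup>2 = 1 - y" using \<open>2 * sp\<^sup>2 = 1 + y\<close> sc by simp
    have "x < 1" using sc(1) pos by (metis less_add_same_cancel1 power2_less_imp_less power_one zero_le_one zero_less_power)
    have "2 * cq\<^sup>2 = 1 + x"
    proof -
      have "1 - x\<^sup>2 + u\<^sup>2 = (1 - x) * 2"
        unfolding uv(1) by (simp add: algebra_simps power2_eq_square)
      then have "(1 - x) * (2 * cq\<^sup>2) = a\<^sup>2" unfolding u2[symmetric] by (simp only: mult.assoc)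
      moreover have "(1 - x) * (1 + x) = a\<^sup>2" using sc(1) by (simp add: algebra_simps power2_eq_square)
      ultimately have "(1 - x) * (2 * cq\<^sup>2) = (1 - x) * (1 + x)" by simp
      then show ?thesis using \<open>x < 1\<close> by simp
    qed
    have "(2 * sp * cp)\<^sup>2 = (2 * sp\<^sup>2) * (2 * cp\<^sup>2)" by (simp add: power_mult_distrib)
    also have "\<dots> = b\<^sup>2"
      unfolding \<open>2 * sp\<^sup>2 = 1 + y\<close> \<open>2 * cp\<^sup>2 = 1 - y\<close> using sc(2)
      by (simp add: algebra_simps power2_eq_square)
    finally have "b\<^sup>2 = (2 * sp * cp)\<^sup>2" by simp
    then have "b = 2 * sp * cp"
      by (rule power2_eq_imp_eq) (use pos in auto)
    then show ?thesis using \<open>2 * cp\<^sup>2 = 1 - y\<close> \<open>2 * cq\<^sup>2 = 1 + x\<close> by simp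
  qed
qed

text \<open>In the application, \<open>a\<close>, \<open>x\<close> are the sine and cosine of \<open>\<alpha>1\<close>, \<open>b\<close>, \<open>y\<close> those of \<open>\<beta>1\<close>,
  \<open>sp\<close>, \<open>cp\<close> those of \<open>\<alpha>2 / 2\<close>, and \<open>sq\<close>, \<open>cq\<close> those of \<open>\<beta>2 / 2\<close>; hence \<open>G = cos \<alpha>2\<close>, \<open>H = cos \<beta>2\<close>.\<close>

locale edge_algebra =
  fixes a b x y sp cp sq cq G H \<rho> :: real
  assumes pos: "a > 0" "b > 0" "x > 0" "y > 0" "sp > 0" "cp > 0" "sq > 0" "cq > 0"
    and sc: "x\<^sup>2 + a\<^sup>2 = 1" "y\<^sup>2 + b\<^sup>2 = 1" "sp\<^sup>2 + cp\<^sup>2 = 1" "sq\<^sup>2 + cq\<^sup>2 = 1"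
    and G: "G = cp\<^sup>2 - sp\<^sup>2" and H: "H = cq\<^sup>2 - sq\<^sup>2"
    and b: "b = \<rho> * (2 * sp * cp)" and a: "\<rho> * a = 2 * sq * cq"
begin

text \<open>These are the quantities of the quartic identity for \<open>r = \<rho>\<^sup>2\<close>;
  its four linear factors say that \<open>U\<close> is plus or minus \<open>\<rho> * (x - y)\<close>
  or \<open>V\<close> is plus or minus \<open>\<rho> * (x + y)\<close>.\<close>

definition U :: real where "U = \<rho>\<^sup>2 * (1 + G) - (1 + H)"

definition V :: real where "V = \<rho>\<^sup>2 * (1 - G) - (1 - H)"

lemma ab: "a * b = 4 * sp * cp * sq * cq"
proof -
  have "a * b = (\<rho> * a) * (2 * sp * cp)" by (simp add: b)
  then show ?thesis unfolding a by simp
qed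

lemma \<rho>_pos: "\<rho> > 0"
proof -
  have "0 < \<rho> * (2 * sp * cp)" using pos(2) by (simp only: b)
  then show ?thesis by (rule zero_less_mult_pos2) (use pos in simp)
qed

lemma \<rho>_eq_1_iff: "\<rho> = 1 \<longleftrightarrow> b = 2 * sp * cp"
  using pos by (auto simp: b)

lemma GH: "1 + G = 2 * cp\<^sup>2" "1 - G = 2 * sp\<^sup>2" "1 + H = 2 * cq\<^sup>2" "1 - H = 2 * sq\<^sup>2"
  using G H sc by auto

lemma U: "U = 2 * ((\<rho> * cp)\<^sup>2 - cq\<^sup>2)" and V: "V = 2 * ((\<rho> * sp)\<^sup>2 - sq\<^sup>2)"
  by (simp_all add: U_def V_def GH power_mult_distrib)

lemma sin_sq_b: "1 - y\<^sup>2 = \<rho>\<^sup>2 * (1 - G\<^sup>2)"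
proof -
  have "1 - G\<^sup>2 = (1 + G) * (1 - G)" by (simp add: algebra_simps power2_eq_square)
  also have "\<dots> = (2 * cp\<^sup>2) * (2 * sp\<^sup>2)" by (simp only: GH)
  finally have "\<rho>\<^sup>2 * (1 - G\<^sup>2) = b\<^sup>2"
    unfolding b by (simp only:) (simp add: power_mult_distrib algebra_simps)
  then show ?thesis using sc by simp
qed

lemma sin_sq_a: "\<rho>\<^sup>2 * (1 - x\<^sup>2) = 1 - H\<^sup>2"
proof -
  have "1 - H\<^sup>2 = (1 + H) * (1 - H)" by (simp add: algebra_simps power2_eq_square)
  also have "\<dots> = (\<rho> * a)\<^sup>2"
    unfolding a by (simp add: GH power_mult_distrib algebra_simps)
  also have "\<dots> = \<rho>\<^sup>2 * (1 - x\<^sup>2)"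
    using sc(1) by (simp add: power_mult_distrib algebra_simps flip: distrib_left)
  finally show ?thesis by simp
qed

text \<open>Identifies the linear factor \<open>U - \<rho> * (x - y)\<close> with the wanted
  relation \<open>sin q sin (p + \<beta>1) = sin p sin (q + \<alpha>1)\<close>, up to positive
  multiples.\<close>

lemma U_diff:
  "\<rho> * (sq * (sp * y + cp * b) - sp * (sq * x + cq * a)) = sp * sq * (U - \<rho> * (x - y))"
proof -
  have "sp * sq * U = \<rho> * cp * sq * (\<rho> * (2 * sp * cp)) - sp * cq * (2 * sq * cq)"
    by (simp add: U algebra_simps power2_eq_square)
  also have "\<dots> = \<rho> * cp * sq * b - sp * cq * (\<rho> * a)"
    by (simp only: a flip: b)
  finally show ?thesis
    by (simp add: algebra_simps)
qed

text \<open>Three of the four factors have to be excluded. The common sign of \<open>U\<close> and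
  \<open>V\<close> decides whether \<open>a < b\<close>, hence whether \<open>y < x\<close>, and
  this contradicts \<open>U = - (\<rho> * (x - y))\<close> unless \<open>x = y\<close>. For the two
  values of \<open>V\<close>, the first alternative of \<open>spurious_factor\<close> is barred by
  \<open>not_both\<close>, and the second gives \<open>U\<close> the sign opposite to that of
  \<open>V\<close>.\<close>

lemma sine_relation_if_edge_condition:
  assumes edge: "(1 - x\<^sup>2 - G\<^sup>2 - y\<^sup>2 - 2 * x * G * y) * b\<^sup>2 
       = (1 - x\<^sup>2 - y\<^sup>2 - H\<^sup>2 - 2 * x * y * H) * (2 * sp * cp)\<^sup>2"
    and Dp: "(1 - G) * (1 - H) < (x + y)\<^sup>2" and Dm: "(1 + G) * (1 + H) > (x - y)\<^sup>2"
    and not_both: "\<not> (x * cq < a * sq \<and> y * cp < b * sp)"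
  shows "sq * (sp * y + cp * b) = sp * (sq * x + cq * a)"
proof -
  have Phi: "(1 - x\<^sup>2 - y\<^sup>2 - H\<^sup>2 - 2 * x * y * H) = \<rho>\<^sup>2 * (1 - x\<^sup>2 - G\<^sup>2 - y\<^sup>2 - 2 * x * G * y)"
  proof -
    have "(2 * sp * cp)\<^sup>2 * (1 - x\<^sup>2 - y\<^sup>2 - H\<^sup>2 - 2 * x * y * H)
      = (2 * sp * cp)\<^sup>2 * (\<rho>\<^sup>2 * (1 - x\<^sup>2 - G\<^sup>2 - y\<^sup>2 - 2 * x * G * y))"
      using edge[symmetric] b by (simp add: power_mult_distrib algebra_simps)
    then show ?thesis using pos by simp
  qed
  have "((x + y)\<^sup>2 - (1 - G) * (1 - H)) * U = ((1 + G) * (1 + H) - (x - y)\<^sup>2) * V"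
    using linear_identity[of x y G H "\<rho>\<^sup>2"] Phi by (simp add: U_def V_def)
  then have same_sign: "U > 0 \<longleftrightarrow> V > 0" "U < 0 \<longleftrightarrow> V < 0"
    using Dp Dm by (metis diff_gt_0_iff_gt zero_less_mult_pos zero_less_mult_pos2 mult_pos_pos,
      metis diff_gt_0_iff_gt mult_less_0_iff less_asym)
  \<comment> \<open>Positivity of \<open>U\<close> and \<open>V\<close> means
    \<open>cq < \<rho> * cp\<close> and \<open>sq < \<rho> * sp\<close>; the product of these
    inequalities compares \<open>\<rho> * a\<close> with \<open>\<rho> * b\<close>.\<close>
  have pos_imp: "a < b" if "U > 0" "V > 0"
  proof -
    have "cq < \<rho> * cp" "sq < \<rho> * sp"
      using that pos \<rho>_pos by (auto simp: U V intro!: power2_less_imp_less)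
    then have "sq * cq < (\<rho> * sp) * (\<rho> * cp)"
      using pos by (intro mult_strict_mono) auto
    then have "\<rho> * a < \<rho> * b" unfolding a by (simp add: b algebra_simps)
    then show ?thesis using \<rho>_pos by simp
  qed
  have neg_imp: "b < a" if "U < 0" "V < 0"
  proof -
    have "\<rho> * cp < cq" "\<rho> * sp < sq"
      using that pos \<rho>_pos by (auto simp: U V intro!: power2_less_imp_less)
    then have "(\<rho> * sp) * (\<rho> * cp) < sq * cq"
      using pos \<rho>_pos by (intro mult_strict_mono) auto
    then have "\<rho> * b < \<rho> * a" unfolding a by (simp add: b algebra_simps)
    then show ?thesis using \<rho>_pos by simp
  qed
  have mono: "a < b \<Longrightarrow> y < x" "b < a \<Longrightarrow> x < y"
  proof -
    assume "a < b"
    then have "a\<^sup>2 < b\<^sup>2" using pos by (simp add: power_strict_mono)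
    then have "y\<^sup>2 < x\<^sup>2" using sc by linarith
    then show "y < x" using pos by (auto intro: power2_less_imp_less)
  next
    assume "b < a"
    then have "b\<^sup>2 < a\<^sup>2" using pos by (simp add: power_strict_mono)
    then have "x\<^sup>2 < y\<^sup>2" using sc by linarith
    then show "x < y" using pos by (auto intro: power2_less_imp_less)
  qed
  have "(U\<^sup>2 - \<rho>\<^sup>2 * (x - y)\<^sup>2) * (V\<^sup>2 - \<rho>\<^sup>2 * (x + y)\<^sup>2) = 0"
    using quartic_identity[OF sin_sq_b sin_sq_a] Phi by (simp add: U_def V_def)
  then consider "U\<^sup>2 = (\<rho> * (x - y))\<^sup>2" | "V\<^sup>2 = (\<rho> * (x + y))\<^sup>2"
    by (auto simp: power_mult_distrib)
  then consider "U = \<rho> * (x - y)" | "U = - (\<rho> * (x - y))" "x \<noteq> y"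
    | "V = \<rho> * (x + y)" | "V = - (\<rho> * (x + y))"
    unfolding power2_eq_iff by fastforce
  then show ?thesis
  proof cases
    case 1
    then have "\<rho> * (sq * (sp * y + cp * b) - sp * (sq * x + cq * a)) = 0"
      using U_diff by simp
    then show ?thesis using \<rho>_pos by simp
  next
    case 2
    show ?thesis
    proof (cases "x < y")
      case True
      then have "U > 0" using 2 \<rho>_pos by (simp add: mult_pos_neg)
      then show ?thesis using same_sign pos_imp mono True by force
    next
      case False
      then have "U < 0" using 2 \<rho>_pos by simp
      then show ?thesis using same_sign neg_imp mono False by force
    qed
  next
    case 3
    have "V > 0" using 3 \<rho>_pos pos by simp
    then have "U > 0" using same_sign by simp
    \<comment> \<open>After division by \<rho>, the equation for \<open>V\<close> is the hypothesis
      \<open>eq\<close> of \<open>spurious_factor\<close>.\<close>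
    have "\<rho> * (b * (sp / cp) - a * (sq / cq)) = (\<rho> * b) * (sp / cp) - (\<rho> * a) * (sq / cq)"
      by (simp add: algebra_simps)
    also have "\<dots> = V"
      unfolding a using pos by (simp add: V b power2_eq_square field_simps)
    finally have "b * (sp / cp) - a * (sq / cq) = x + y" using 3 \<rho>_pos by simp
    from spurious_factor[OF pos sc ab this] not_both
    have "b = 2 * sp * cp" "2 * (cp\<^sup>2 - cq\<^sup>2) = - (x + y)" by auto
    then have "\<rho> = 1" by (simp only: \<rho>_eq_1_iff)
    then have "U = - (x + y)" using U \<open>2 * (cp\<^sup>2 - cq\<^sup>2) = - (x + y)\<close> by simp
    then show ?thesis using \<open>U > 0\<close> pos by simp
  next
    case 4
    have "V < 0" using 4 \<rho>_pos pos by simp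
    then have "U < 0" using same_sign by simp
    have "\<rho> * (a * (sq / cq) - b * (sp / cp)) = (\<rho> * a) * (sq / cq) - (\<rho> * b) * (sp / cp)"
      by (simp add: algebra_simps)
    also have "\<dots> = - V"
      unfolding a using pos by (simp add: V b power2_eq_square field_simps)
    finally have "a * (sq / cq) - b * (sp / cp) = y + x" using 4 \<rho>_pos by (simp add: add.commute)
    from spurious_factor[OF pos(2,1,4,3,7,8,5,6) sc(2,1,4,3) _ this] not_both ab
    have "a = 2 * sq * cq" "2 * (cq\<^sup>2 - cp\<^sup>2) = - (x + y)" by (auto simp: algebra_simps)
    then have "\<rho> = 1" using a pos by simp
    then have "U = x + y" using U \<open>2 * (cq\<^sup>2 - cp\<^sup>2) = - (x + y)\<close> by simp
    then show ?thesis using \<open>U < 0\<close> pos by simp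
  qed
qed

text \<open>The quartic identity read backwards: one vanishing factor kills its left side, and the
  right side may then be divided by \<open>\<rho>\<^sup>2 - 1\<close>.\<close>

lemma edge_condition_if_sine_relation:
  assumes rel: "sq * (sp * y + cp * b) = sp * (sq * x + cq * a)"
    and ne: "b \<noteq> 2 * sp * cp"
  shows "(1 - x\<^sup>2 - G\<^sup>2 - y\<^sup>2 - 2 * x * G * y) * b\<^sup>2
       = (1 - x\<^sup>2 - y\<^sup>2 - H\<^sup>2 - 2 * x * y * H) * (2 * sp * cp)\<^sup>2"
proof -
  have "\<rho> \<noteq> 1" using ne unfolding \<rho>_eq_1_iff .
  then have "\<rho>\<^sup>2 \<noteq> 1" using \<rho>_pos by (simp add: power2_eq_1_iff)
  have "U = \<rho> * (x - y)" using U_diff rel pos by simp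
  then have "U\<^sup>2 - \<rho>\<^sup>2 * (x - y)\<^sup>2 = 0" by (simp add: power_mult_distrib)
  then have "- 4 * \<rho>\<^sup>2 * (\<rho>\<^sup>2 - 1) * ((1 - x\<^sup>2 - y\<^sup>2 - H\<^sup>2 - 2 * x * y * H)
      - \<rho>\<^sup>2 * (1 - x\<^sup>2 - G\<^sup>2 - y\<^sup>2 - 2 * x * G * y)) = 0"
    using quartic_identity[OF sin_sq_b sin_sq_a] unfolding U_def by simp
  then have "1 - x\<^sup>2 - y\<^sup>2 - H\<^sup>2 - 2 * x * y * H = \<rho>\<^sup>2 * (1 - x\<^sup>2 - G\<^sup>2 - y\<^sup>2 - 2 * x * G * y)"
    using \<open>\<rho>\<^sup>2 \<noteq> 1\<close> \<rho>_pos by simp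
  moreover have "b\<^sup>2 = \<rho>\<^sup>2 * (2 * sp * cp)\<^sup>2"
    by (subst b) (simp only: power_mult_distrib)
  ultimately show ?thesis by simp
qed

end

section \<open>Back to angles: the sine relations of a proper solution\<close>

lemma edge_algebra_of_sine_product:
  fixes \<alpha> \<beta> p q :: real
  assumes pos: "sin \<alpha> > 0" "sin \<beta> > 0" "cos \<alpha> > 0" "cos \<beta> > 0"
      "sin p > 0" "cos p > 0" "sin q > 0" "cos q > 0"
    and prod: "sin \<alpha> * sin \<beta> = sin (2 * p) * sin (2 * q)"
  shows "edge_algebra (sin \<alpha>) (sin \<beta>) (cos \<alpha>) (cos \<beta>) (sin p) (cos p) (sin q) (cos q)
    (cos (2 * p)) (cos (2 * q)) (sin \<beta> / sin (2 * p))"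
proof -
  have "sin (2 * p) > 0" using pos by (simp add: sin_double)
  then have "sin \<beta> / sin (2 * p) * sin \<alpha> = sin (2 * q)"
    using prod by (simp add: field_simps)
  then show ?thesis
    using pos \<open>sin (2 * p) > 0\<close> by unfold_locales (simp_all add: sin_double cos_double)
qed

text \<open>The left side is \<open>4 (sin p sin q)\<^sup>2\<close>. Complementary angles give
  \<open>sin p \<le> cos \<alpha>1\<close> and \<open>sin q \<le> cos \<beta>1\<close>; the
  inequality of arithmetic and geometric means and \<open>sin p sin q < 1\<close> do the
  rest.\<close>

lemma first_det_factor_neg:
  fixes \<alpha>1 \<beta>1 p q :: real
  assumes pos: "\<alpha>1 > 0" "\<beta>1 > 0" "p > 0" "q > 0"
    and le: "\<alpha>1 + p \<le> pi / 2" "\<beta>1 + q < pi / 2"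
  shows "(1 - cos (2 * p)) * (1 - cos (2 * q)) < (cos \<alpha>1 + cos \<beta>1)\<^sup>2"
proof -
  have trig_pos: "sin p > 0" "sin q > 0"
    using pos le by (auto intro!: sin_gt_zero)
  have "sin p \<le> cos \<alpha>1"
    using cos_monotone_0_pi_le[of \<alpha>1 "pi / 2 - p"] pos le by (simp add: cos_diff)
  moreover have "sin q \<le> cos \<beta>1"
    using cos_monotone_0_pi_le[of \<beta>1 "pi / 2 - q"] pos le by (simp add: cos_diff)
  ultimately have "(sin p + sin q)\<^sup>2 \<le> (cos \<alpha>1 + cos \<beta>1)\<^sup>2"
    using trig_pos by (intro power_mono) auto
  moreover have "4 * (sin p * sin q) \<le> (sin p + sin q)\<^sup>2"
    using zero_le_power2[of "sin p - sin q"] by (simp add: algebra_simps power2_eq_square)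
  moreover have "(1 - cos (2 * p)) * (1 - cos (2 * q)) = 4 * (sin p * sin q) * (sin p * sin q)"
    by (simp add: cos_double_sin power2_eq_square)
  moreover have "sin p * sin q < 1"
  proof -
    have "sin p * sin q \<le> sin q" using trig_pos by simp
    also have "sin q < 1" using sin_monotone_2pi[of q "pi / 2"] pos le by simp
    finally show ?thesis .
  qed
  then have "4 * (sin p * sin q) * (sin p * sin q) < 4 * (sin p * sin q)"
    using trig_pos by simp
  ultimately show "(1 - cos (2 * p)) * (1 - cos (2 * q)) < (cos \<alpha>1 + cos \<beta>1)\<^sup>2"
    by linarith
qed

lemma sine_relation_of_proper:
  fixes \<alpha>1 \<beta>1 p q :: real
  assumes pos: "\<alpha>1 > 0" "\<beta>1 > 0" "p > 0" "q > 0"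
    and le: "\<alpha>1 + p \<le> pi / 2" "\<beta>1 + q < pi / 2"
    and edge: "edge_conditions \<alpha>1 (2 * p) \<beta>1 (2 * q)" and "proper \<alpha>1 (2 * p) \<beta>1 (2 * q)"
  shows "sin \<alpha>1 * sin \<beta>1 = sin (2 * p) * sin (2 * q)"
    and "sin q * sin (p + \<beta>1) = sin p * sin (q + \<alpha>1)"
proof -
  note minors = proper_imp_minors_neg[OF assms(8)]
  have trig_pos: "sin \<alpha>1 > 0" "sin \<beta>1 > 0" "cos \<alpha>1 > 0" "cos \<beta>1 > 0"
    "sin p > 0" "cos p > 0" "sin q > 0" "cos q > 0"
    using pos le by (auto intro!: sin_gt_zero cos_gt_zero)
  show E1: "sin \<alpha>1 * sin \<beta>1 = sin (2 * p) * sin (2 * q)"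
    using sine_product_of_edge_conditions[OF edge minors(1,2)] trig_pos by (simp add: sin_double)
  have Dp: "(1 - cos (2 * p)) * (1 - cos (2 * q)) < (cos \<alpha>1 + cos \<beta>1)\<^sup>2"
    by (rule first_det_factor_neg) (use assms in auto)
  then have Dm: "(1 + cos (2 * p)) * (1 + cos (2 * q)) > (cos \<alpha>1 - cos \<beta>1)\<^sup>2"
    using minors(3) by (simp add: det_coxeter_schlaefli mult_less_0_iff)
  \<comment> \<open>Both inequalities together would make \<alpha>1 + q and \<beta>1 + p exceed
    pi/2, but the four angles add up to less than pi.\<close>
  have not_both: "\<not> (cos \<alpha>1 * cos q < sin \<alpha>1 * sin q \<and> cos \<beta>1 * cos p < sin \<beta>1 * sin p)"
  proof
    assume "cos \<alpha>1 * cos q < sin \<alpha>1 * sin q \<and> cos \<beta>1 * cos p < sin \<beta>1 * sin p"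
    then have "cos (\<alpha>1 + q) < 0" "cos (\<beta>1 + p) < 0" by (auto simp: cos_add)
    then have "\<alpha>1 + q > pi / 2" "\<beta>1 + p > pi / 2"
      using cos_ge_zero[of "\<alpha>1 + q"] cos_ge_zero[of "\<beta>1 + p"] pos by (auto simp: not_le[symmetric])
    then show False using le by simp
  qed
  have "sin q * (sin p * cos \<beta>1 + cos p * sin \<beta>1) = sin p * (sin q * cos \<alpha>1 + cos q * sin \<alpha>1)"
  proof (rule edge_algebra.sine_relation_if_edge_condition
      [OF edge_algebra_of_sine_product[OF trig_pos E1] _ Dp Dm not_both])
    show "(1 - (cos \<alpha>1)\<^sup>2 - (cos (2 * p))\<^sup>2 - (cos \<beta>1)\<^sup>2 - 2 * cos \<alpha>1 * cos (2 * p) * cos \<beta>1) * (sin \<beta>1)\<^sup>2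
      = (1 - (cos \<alpha>1)\<^sup>2 - (cos \<beta>1)\<^sup>2 - (cos (2 * q))\<^sup>2 - 2 * cos \<alpha>1 * cos \<beta>1 * cos (2 * q)) * (2 * sin p * cos p)\<^sup>2"
      using edge by (simp add: edge_conditions_def f1_def B00_def B11_def sin_double)
  qed
  then show "sin q * sin (p + \<beta>1) = sin p * sin (q + \<alpha>1)"
    by (simp add: sin_add)
qed

section \<open>Reduction to one variable\<close>

text \<open>This form exhibits the logarithmic derivative of the tangent, convenient for quotients
  of tangents.\<close>

lemma tan_has_derivative_double_angle:
  fixes x :: real
  assumes "sin x \<noteq> 0" "cos x \<noteq> 0"
  shows "(tan has_real_derivative 2 * tan x / sin (2 * x)) (at x)"
proof -
  have "inverse ((cos x)\<^sup>2) = 2 * tan x / sin (2 * x)"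
    using assms by (simp add: sin_double tan_def power2_eq_square divide_simps)
  then show ?thesis using DERIV_tan[OF assms(2)] by simp
qed

text \<open>\<open>h_cases\<close> retains what is needed from \<open>a\<close> and \<open>b\<close>
  being integers: either \<open>a = 2\<close> and \<open>b \<ge> 3\<close>, or
  \<open>a \<ge> 3\<close>.\<close>

locale angle_pair =
  fixes h k :: real
  assumes k_pos: "0 < k" and k_less_h: "k < h"
    and h_cases: "h = pi / 2 \<and> k \<le> pi / 3 \<or> h \<le> pi / 3"
begin

section \<open>The function M, its bounds and its derivative\<close>

definition M :: "real \<Rightarrow> real" where
  "M N = 2 * arctan (tan ((h + k) / 2) * tan (N / 2) / tan ((h - k) / 2 + N))"

text \<open>Up to sign, this is the bracket on the right of \<open>sine_product_defect\<close> with
  \<open>p + q = M N\<close>, so its zeros are those \<open>N\<close> for which the product relation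
  holds.\<close>

definition g :: "real \<Rightarrow> real" where
  "g N = (sin N)\<^sup>2 * (cos (M N) + cos N) - (sin ((h - k + N) / 2))\<^sup>2 * (cos (h + k) + cos N)"

lemma h_le: "h \<le> pi / 2"
  using h_cases pi_gt_zero by linarith

lemma T_pos: "tan ((h + k) / 2) > 0"
  using k_pos k_less_h h_le by (intro tan_gt_zero) auto

lemma arg_bounds:
  assumes "0 \<le> N" "N \<le> h - k" "N \<le> k"
  shows "0 < (h - k) / 2 + N" "(h - k) / 2 + N < pi / 2" "N / 2 < (h - k) / 2 + N"
    "tan ((h - k) / 2 + N) > 0" "tan (N / 2) < tan ((h - k) / 2 + N)"
proof -
  show *: "0 < (h - k) / 2 + N" "(h - k) / 2 + N < pi / 2" "N / 2 < (h - k) / 2 + N"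
    using assms k_pos k_less_h h_le unfolding diff_divide_distrib by - linarith+
  show "tan ((h - k) / 2 + N) > 0" using * by (intro tan_gt_zero) auto
  show "tan (N / 2) < tan ((h - k) / 2 + N)" using * assms pi_gt_zero by (intro tan_monotone) auto
qed

lemma tan_half_M: "tan (M N / 2) = tan ((h + k) / 2) * tan (N / 2) / tan ((h - k) / 2 + N)"
  by (simp add: M_def tan_arctan)

lemma M_nonneg: "0 \<le> N \<Longrightarrow> N \<le> h - k \<Longrightarrow> N \<le> k \<Longrightarrow> 0 \<le> M N"
  using arg_bounds[of N] T_pos tan_pos_pi2_le[of "N / 2"] k_pos h_le k_less_h
  by (auto simp: M_def zero_le_arctan_iff)

lemma M_pos: "0 < N \<Longrightarrow> N \<le> h - k \<Longrightarrow> N \<le> k \<Longrightarrow> 0 < M N"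
  using arg_bounds[of N] T_pos tan_gt_zero[of "N / 2"] k_pos h_le k_less_h
  by (auto simp: M_def zero_less_arctan_iff)

lemma M_less_sum:
  assumes "0 \<le> N" "N \<le> h - k" "N \<le> k"
  shows "M N < h + k"
proof -
  have "tan ((h + k) / 2) * tan (N / 2) / tan ((h - k) / 2 + N) < tan ((h + k) / 2)"
    using arg_bounds[OF assms] T_pos by (simp add: field_simps)
  then have "M N < 2 * arctan (tan ((h + k) / 2))"
    by (simp add: M_def arctan_less_iff)
  also have "\<dots> = h + k"
    using k_pos k_less_h h_le by (subst arctan_tan) auto
  finally show ?thesis .
qed

lemma cos_M_gt: "0 \<le> N \<Longrightarrow> N \<le> h - k \<Longrightarrow> N \<le> k \<Longrightarrow> cos (h + k) < cos (M N)"
  using M_less_sum[of N] M_nonneg[of N] k_less_h h_le by (intro cos_monotone_0_pi) auto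

text \<open>This amounts to \<open>M N \<le> pi / 2\<close>, hence \<open>cos (M N) \<ge> 0\<close>.
  If \<open>h \<le> pi / 3\<close>, the first tangent is below 2 and
  \<open>2 tan (N/2) \<le> tan N\<close>. The case \<open>h = pi / 2\<close> is tighter and uses
  \<open>k \<le> pi / 3\<close> fully.\<close>

lemma tan_arg_le_1:
  assumes "0 < N" "N \<le> h - k" "N \<le> k"
  shows "tan ((h + k) / 2) * tan (N / 2) \<le> tan ((h - k) / 2 + N)"
  using h_cases
proof
  assume "h \<le> pi / 3"
  have "tan ((h + k) / 2) < tan (pi / 3)"
    using \<open>h \<le> pi / 3\<close> k_pos k_less_h by (intro tan_monotone) auto
  also have "\<dots> < 2" using real_sqrt_less_mono[of 3 4] by (simp add: tan_60)
  finally have "tan ((h + k) / 2) * tan (N / 2) \<le> 2 * tan (N / 2)"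
    using assms h_le k_less_h k_pos tan_gt_zero[of "N / 2"] by (intro mult_right_mono) auto
  also have "\<dots> \<le> tan N"
  proof -
    have N: "0 < N / 2" "N / 2 < pi / 4" using assms \<open>h \<le> pi / 3\<close> k_less_h k_pos by auto
    then have t: "0 < tan (N / 2)" "tan (N / 2) < 1"
      using tan_gt_zero[of "N / 2"] tan_monotone[of "N / 2" "pi / 4"] by (auto simp: tan_45)
    have "cos (N / 2) \<noteq> 0" "cos (2 * (N / 2)) \<noteq> 0"
      using N by (auto intro!: less_imp_neq[symmetric] cos_gt_zero)
    from tan_double[OF this] have "tan N = 2 * tan (N / 2) / (1 - (tan (N / 2))\<^sup>2)" by simp
    moreover have "0 < 1 - (tan (N / 2))\<^sup>2" "1 - (tan (N / 2))\<^sup>2 \<le> 1"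
      using t by (auto simp: power_less_one_iff)
    ultimately show ?thesis using t by (simp add: le_divide_eq)
  qed
  also have "\<dots> \<le> tan ((h - k) / 2 + N)"
    using arg_bounds[of N] assms k_less_h by (intro less_imp_le tan_monotone) auto
  finally show ?thesis .
next
  assume hk: "h = pi / 2 \<and> k \<le> pi / 3"
  \<comment> \<open>Now \<open>tan ((h + k) / 2)\<close> is the cotangent of \<open>z / 2\<close>,
    and the claim becomes \<open>tan (N/2) \<le> tan (z/2) tan (z/2 + N)\<close>, where the right
    side is the quotient of \<open>cos N - cos (z + N)\<close> by
    \<open>cos N + cos (z + N)\<close>. It suffices that
    \<open>cos (z + N) \<le> 1 - sin N\<close>.\<close>
  define z where "z = h - k"
  have z: "pi / 6 \<le> z" "z < pi / 2" using hk k_pos by (auto simp: z_def)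
  define c s where "c = cos (N / 2)" and "s = sin (N / 2)"
  have N: "0 < N / 2" "N / 2 < pi / 4" using assms hk z by (auto simp: z_def)
  then have cs: "c > 0" "s > 0" by (auto simp: c_def s_def intro!: cos_gt_zero sin_gt_zero)
  have "sin N = 2 * s * c" "cos N = (c + s) * (c - s)" "s\<^sup>2 + c\<^sup>2 = 1"
    using sin_double[of "N / 2"] cos_double[of "N / 2"]
    by (auto simp: c_def s_def algebra_simps power2_eq_square)
  have "cos (z + N) + sin N = cos (z + N) + cos (pi / 2 - N)"
    by (simp add: cos_diff)
  also have "\<dots> = 2 * cos (z / 2 + pi / 4) * cos (z / 2 + N - pi / 4)"
  proof -
    have "(z + N + (pi / 2 - N)) / 2 = z / 2 + pi / 4" "(z + N - (pi / 2 - N)) / 2 = z / 2 + N - pi / 4"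
      unfolding diff_divide_distrib add_divide_distrib by simp_all
    then show ?thesis by (simp only: cos_plus_cos)
  qed
  also have "\<dots> \<le> 2 * cos (z / 2 + pi / 4) * 1"
    using z by (intro mult_left_mono) (auto intro!: cos_ge_zero)
  also have "cos (z / 2 + pi / 4) \<le> cos (pi / 3)"
    using z by (intro cos_monotone_0_pi_le) auto
  finally have "cos (z + N) \<le> 1 - sin N" by (simp add: cos_60)
  also have "\<dots> = (c - s)\<^sup>2"
    using \<open>sin N = 2 * s * c\<close> \<open>s\<^sup>2 + c\<^sup>2 = 1\<close> by (simp add: power2_diff)
  finally have "(c + s) * cos (z + N) \<le> (c + s) * (c - s)\<^sup>2"
    using cs by (intro mult_left_mono) auto
  also have "\<dots> = cos N * (c - s)"
    unfolding \<open>cos N = (c + s) * (c - s)\<close> by (simp add: power2_eq_square)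
  finally have "(cos N + cos (z + N)) * s \<le> (cos N - cos (z + N)) * c"
    by (simp add: algebra_simps)
  moreover have sum: "cos N + cos (z + N) = 2 * (cos (z / 2) * cos (z / 2 + N))"
    using cos_times_cos[of "z / 2" "z / 2 + N"] by (simp add: add.commute)
  moreover have diff: "cos N - cos (z + N) = 2 * (sin (z / 2) * sin (z / 2 + N))"
    using sin_times_sin[of "z / 2" "z / 2 + N"] by (simp add: add.commute)
  ultimately have "2 * (cos (z / 2) * cos (z / 2 + N)) * s \<le> 2 * (sin (z / 2) * sin (z / 2 + N)) * c"
    by (simp only: sum diff)
  then have *: "cos (z / 2) * s * cos (z / 2 + N) \<le> sin (z / 2) * c * sin (z / 2 + N)"
    by (simp add: mult_ac)
  have pos: "sin (z / 2) > 0" "cos (z / 2) > 0" "sin (z / 2 + N) > 0" "cos (z / 2 + N) > 0"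
  proof -
    have "0 < z / 2 + N" "z / 2 + N < pi / 2"
      using arg_bounds(1,2)[of N] assms by (simp_all add: z_def)
    then show "sin (z / 2) > 0" "cos (z / 2) > 0" "sin (z / 2 + N) > 0" "cos (z / 2 + N) > 0"
      using z by (intro sin_gt_zero cos_gt_zero; linarith)+
  qed
  have "(h + k) / 2 = pi / 2 - z / 2" using hk by (simp add: z_def field_simps)
  then have "tan ((h + k) / 2) = cos (z / 2) / sin (z / 2)"
    by (simp only: tan_def sin_diff cos_diff) simp
  moreover have "tan ((h - k) / 2 + N) = sin (z / 2 + N) / cos (z / 2 + N)"
    by (simp add: tan_def z_def)
  moreover have "tan (N / 2) = s / c" by (simp add: tan_def s_def c_def)
  moreover have "cos (z / 2) / sin (z / 2) * (s / c) \<le> sin (z / 2 + N) / cos (z / 2 + N)"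
  proof -
    have "x / y * (s / c) \<le> u / v" if "x * s * v \<le> y * c * u" "y > 0" "v > 0" for x y u v :: real
      using that cs by (simp add: field_simps)
    then show ?thesis using * pos by blast
  qed
  ultimately show ?thesis by (simp only:)
qed

lemma M_le_pi_half:
  assumes "0 < N" "N \<le> h - k" "N \<le> k"
  shows "M N \<le> pi / 2"
proof -
  have "tan ((h + k) / 2) * tan (N / 2) / tan ((h - k) / 2 + N) \<le> 1"
    using tan_arg_le_1[OF assms] arg_bounds[of N] assms by (simp add: divide_le_eq_1)
  then have "arctan (tan ((h + k) / 2) * tan (N / 2) / tan ((h - k) / 2 + N)) \<le> arctan 1"
    by (simp add: arctan_le_iff)
  then show ?thesis by (simp add: M_def arctan_one)
qed

text \<open>With \<open>M = 2 arctan m\<close>, the derivative is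
  \<open>2 m / (1 + m\<^sup>2)\<close>, which is \<open>sin M\<close>, times the logarithmic
  derivative of \<open>m\<close>.\<close>

lemma M_has_derivative:
  assumes "0 < N" "N \<le> h - k" "N \<le> k"
  shows "(M has_real_derivative sin (M N) * (1 / sin N - 2 / sin (h - k + 2 * N))) (at N)"
proof -
  define T where "T = tan ((h + k) / 2)"
  define u where "u = tan (N / 2)"
  define w where "w = tan ((h - k) / 2 + N)"
  define m where "m = T * u / w"
  note b = arg_bounds[OF less_imp_le[OF assms(1)] assms(2,3)]
  have N: "N / 2 < pi / 2" using assms k_less_h h_le by auto
  have nz: "sin (N / 2) > 0" "cos (N / 2) > 0" "sin ((h - k) / 2 + N) > 0" "cos ((h - k) / 2 + N) > 0"
    using b N assms by (intro sin_gt_zero cos_gt_zero; linarith)+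
  have "w > 0" using b by (simp add: w_def)
  have du: "((\<lambda>N. tan (N / 2)) has_real_derivative u / sin N) (at N)"
  proof -
    have "(tan has_real_derivative 2 * u / sin N) (at (N / 2))"
      using tan_has_derivative_double_angle[of "N / 2"] nz by (simp add: u_def)
    then have "((\<lambda>N. tan (N / 2)) has_real_derivative 2 * u / sin N * (1 / 2)) (at N)"
      by (rule DERIV_chain2) (auto intro!: derivative_eq_intros)
    then show ?thesis by simp
  qed
  have dw: "((\<lambda>N. tan ((h - k) / 2 + N)) has_real_derivative 2 * w / sin (h - k + 2 * N)) (at N)"
  proof -
    have "2 * ((h - k) / 2 + N) = h - k + 2 * N" unfolding diff_divide_distrib by simp
    then have "(tan has_real_derivative 2 * w / sin (h - k + 2 * N)) (at ((h - k) / 2 + N))"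
      using tan_has_derivative_double_angle[of "(h - k) / 2 + N"] nz
      unfolding \<open>2 * ((h - k) / 2 + N) = h - k + 2 * N\<close> by (simp add: w_def)
    then have "((\<lambda>N. tan ((h - k) / 2 + N)) has_real_derivative 2 * w / sin (h - k + 2 * N) * 1) (at N)"
      by (rule DERIV_chain2) (auto intro!: derivative_eq_intros)
    then show ?thesis by simp
  qed
  define D where "D = 1 / sin N - 2 / sin (h - k + 2 * N)"
  have dm: "((\<lambda>N. T * tan (N / 2) / tan ((h - k) / 2 + N)) has_real_derivative m * D) (at N)"
  proof -
    have "((\<lambda>N. T * tan (N / 2) / tan ((h - k) / 2 + N)) has_real_derivative
        (T * (u / sin N) * w - T * u * (2 * w / sin (h - k + 2 * N))) / (w * w)) (at N)"
      using DERIV_divide[OF DERIV_cmult[OF du, of T] dw] \<open>w > 0\<close> by (simp add: u_def w_def)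
    moreover have "(T * (u / sin N) * w - T * u * (2 * w / sin (h - k + 2 * N))) / (w * w)
        = T * u * w * D / (w * w)"
      by (simp add: D_def right_diff_distrib mult_ac)
    moreover have "T * u * w * D / (w * w) = m * D"
      using \<open>w > 0\<close> by (simp add: m_def)
    ultimately show ?thesis by (simp only:)
  qed
  have dM: "(M has_real_derivative 2 * (m * D / (1 + m\<^sup>2))) (at N)"
  proof -
    have "(arctan has_real_derivative inverse (1 + m\<^sup>2)) (at (T * tan (N / 2) / tan ((h - k) / 2 + N)))"
      using DERIV_arctan[of m] by (simp add: m_def u_def w_def)
    then have "((\<lambda>N. arctan (T * tan (N / 2) / tan ((h - k) / 2 + N))) has_real_derivative
        inverse (1 + m\<^sup>2) * (m * D)) (at N)"
      by (rule DERIV_chain2[OF _ dm])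
    from DERIV_cmult[OF this, of 2] show ?thesis
      unfolding M_def[abs_def] T_def[symmetric] by (simp only: divide_inverse mult_ac)
  qed
  have "sin (M N) = 2 * m / (1 + m\<^sup>2)"
  proof -
    have "M N = 2 * arctan m" by (simp add: M_def m_def T_def u_def w_def)
    then have "sin (M N) = 2 * (m / sqrt (1 + m\<^sup>2)) * (1 / sqrt (1 + m\<^sup>2))"
      by (simp add: sin_double sin_arctan cos_arctan)
    also have "\<dots> = 2 * m / (sqrt (1 + m\<^sup>2))\<^sup>2" by (simp add: power2_eq_square)
    finally show ?thesis by (simp add: add_nonneg_nonneg)
  qed
  then have "2 * (m * D / (1 + m\<^sup>2)) = sin (M N) * D" by simp
  then show ?thesis using dM by (simp only: D_def)
qed

section \<open>Monotonicity of the logarithmic ratio: at most one zero of g\<close>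

lemma positivity:
  assumes "0 < N" "N < h - k" "N \<le> k"
  shows "sin N > 0" "cos N > 0" "sin ((h - k + N) / 2) > 0" "cos (M N) \<ge> 0"
    "cos (h + k) + cos N > 0" "sin (h - k + 2 * N) > 0"
proof -
  show "sin N > 0" "cos N > 0" "sin (h - k + 2 * N) > 0"
    using assms k_pos k_less_h h_le by (intro sin_gt_zero cos_gt_zero; linarith)+
  show "sin ((h - k + N) / 2) > 0"
    using assms k_pos k_less_h h_le by (intro sin_gt_zero) auto
  show "cos (M N) \<ge> 0"
    using M_le_pi_half[of N] M_pos[of N] assms by (intro cos_ge_zero) auto
  have "cos (h + k) + cos N = 2 * cos ((h + k + N) / 2) * cos ((h + k - N) / 2)"
    by (simp add: cos_plus_cos)
  moreover have "cos ((h + k + N) / 2) > 0" "cos ((h + k - N) / 2) > 0"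
    using assms k_pos k_less_h h_le by (auto intro!: cos_gt_zero_pi)
  ultimately show "cos (h + k) + cos N > 0" by simp
qed

text \<open>Logarithm of the ratio of the two positive terms whose difference is \<open>g N\<close>.
  Its derivative is a sum of terms that can be compared in pairs.\<close>

definition L :: "real \<Rightarrow> real" where
  "L N = 2 * ln (sin N) + ln (cos (M N) + cos N)
    - (2 * ln (sin ((h - k + N) / 2)) + ln (cos (h + k) + cos N))"

lemma L_has_derivative:
  assumes "0 < N" "N < h - k" "N \<le> k"
  shows "(L has_real_derivative 2 * (cos N / sin N)
    + (- sin (M N) * (sin (M N) * (1 / sin N - 2 / sin (h - k + 2 * N))) - sin N) / (cos (M N) + cos N)
    - (cos ((h - k + N) / 2) / sin ((h - k + N) / 2) - sin N / (cos (h + k) + cos N))) (at N)"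
proof -
  note pos = positivity[OF assms]
  have cc: "cos (M N) + cos N > 0" using pos by simp
  have M': "(M has_real_derivative sin (M N) * (1 / sin N - 2 / sin (h - k + 2 * N))) (at N)"
    using M_has_derivative assms by simp
  have 1: "((\<lambda>N. 2 * ln (sin N)) has_real_derivative 2 * (cos N / sin N)) (at N)"
    using pos by (auto intro!: derivative_eq_intros)
  have 2: "((\<lambda>N. ln (cos (M N) + cos N)) has_real_derivative
      (- sin (M N) * (sin (M N) * (1 / sin N - 2 / sin (h - k + 2 * N))) - sin N) / (cos (M N) + cos N)) (at N)"
    using cc by (auto intro!: derivative_eq_intros M' simp: divide_inverse algebra_simps)
  have "((\<lambda>N. sin ((h - k + N) / 2)) has_real_derivative cos ((h - k + N) / 2) * (1 / 2)) (at N)"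
    by (rule derivative_eq_intros refl | simp)+
  then have 3: "((\<lambda>N. 2 * ln (sin ((h - k + N) / 2))) has_real_derivative
      cos ((h - k + N) / 2) / sin ((h - k + N) / 2)) (at N)"
    using pos by (auto intro!: derivative_eq_intros)
  have "((\<lambda>N. cos (h + k) + cos N) has_real_derivative - sin N) (at N)"
    using DERIV_add[OF DERIV_const DERIV_cos] by simp
  from DERIV_chain2[OF DERIV_ln_divide this] pos(5)
  have 4: "((\<lambda>N. ln (cos (h + k) + cos N)) has_real_derivative - (sin N / (cos (h + k) + cos N))) (at N)"
    by simp
  from DERIV_diff[OF DERIV_add[OF 1 2] DERIV_add[OF 3 4]] show ?thesis
    unfolding L_def[abs_def] by (simp only: diff_conv_add_uminus)
qed

text \<open>The derivative contains \<open>cot N\<close> twice. One copy beats \<open>cot d\<close>,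
  since \<open>N < d\<close>; the other beats the contribution \<open>Q * R\<close> of the
  derivative of \<open>M\<close>. The two remaining terms compare by
  \<open>cos (h + k) < cos (M N)\<close>.\<close>

lemma L_strict_mono:
  assumes "0 < N1" "N1 < N2" "N2 < h - k" "N2 \<le> k"
  shows "L N1 < L N2"
proof (rule DERIV_pos_imp_increasing[OF assms(2)])
  fix N assume "N1 \<le> N" "N \<le> N2"
  then have N: "0 < N" "N < h - k" "N \<le> k" using assms by auto
  note pos = positivity[OF N]
  define d where "d = (h - k + N) / 2"
  define Q where "Q = (sin (M N))\<^sup>2 / (cos (M N) + cos N)"
  define R where "R = 1 / sin N - 2 / sin (h - k + 2 * N)"
  have cot: "cos d / sin d < cos N / sin N"
  proof -
    have "sin (d - N) > 0"
      using N k_pos k_less_h h_le by (intro sin_gt_zero) (auto simp: d_def field_simps)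
    moreover have "sin d > 0" using pos by (simp add: d_def)
    ultimately show ?thesis
      using pos(1) by (simp add: sin_diff divide_simps mult_ac)
  qed
  have sec: "sin N / (cos (M N) + cos N) \<le> sin N / (cos (h + k) + cos N)"
    using pos cos_M_gt[of N] N by (intro divide_left_mono) auto
  have Q: "0 \<le> Q" "Q \<le> 1 / cos N"
  proof -
    show "0 \<le> Q" using pos by (simp add: Q_def)
    have "(sin (M N))\<^sup>2 \<le> 1" by (simp add: abs_square_le_1)
    then show "Q \<le> 1 / cos N"
      unfolding Q_def using pos by (intro frac_le) auto
  qed
  \<comment> \<open>For positive \<open>R\<close>, the bound \<open>Q \<le> 1 / cos N\<close> is
    enough: \<open>1 / (sin N cos N) = cot N + tan N\<close>, and the subtracted part of
    \<open>R\<close> outweighs \<open>tan N\<close>.\<close>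
  have "Q * R < cos N / sin N"
  proof (cases "R \<le> 0")
    case True
    then have "Q * R \<le> 0" using Q by (simp add: mult_nonneg_nonpos)
    also have "0 < cos N / sin N" using pos by simp
    finally show ?thesis .
  next
    case False
    then have "Q * R \<le> 1 / cos N * R" using Q by (intro mult_right_mono) auto
    also have "\<dots> < cos N / sin N"
    proof -
      have "1 / (sin N * cos N) = cos N / sin N + sin N / cos N"
        using pos sin_cos_squared_add[of N] by (simp add: field_simps power2_eq_square)
      moreover have "sin N / cos N < 1 / cos N * (2 / sin (h - k + 2 * N))"
      proof -
        have "sin N * sin (h - k + 2 * N) \<le> 1"
          using pos by (intro mult_le_one) auto
        then have "sin N < 2 / sin (h - k + 2 * N)"
          using pos by (simp add: less_divide_eq)
        from divide_strict_right_mono[OF this pos(2)] show ?thesis by (simp add: mult.commute)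
      qed
      moreover have "1 / cos N * R = 1 / (sin N * cos N) - 1 / cos N * (2 / sin (h - k + 2 * N))"
        by (simp add: R_def algebra_simps)
      ultimately show ?thesis by linarith
    qed
    finally show ?thesis .
  qed
  then have "0 < 2 * (cos N / sin N) + (- (Q * R) - sin N / (cos (M N) + cos N))
      - (cos d / sin d - sin N / (cos (h + k) + cos N))"
    using cot sec by linarith
  also have "- (Q * R) - sin N / (cos (M N) + cos N)
      = (- sin (M N) * (sin (M N) * R) - sin N) / (cos (M N) + cos N)"
    by (simp add: Q_def diff_divide_distrib power2_eq_square)
  finally show "\<exists>y. (L has_real_derivative y) (at N) \<and> 0 < y"
    using L_has_derivative[OF N] unfolding R_def d_def by blast
qed

lemma g_L:
  assumes "0 < N" "N < h - k" "N \<le> k"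
  shows "g N = 0 \<longleftrightarrow> L N = 0" "g N > 0 \<longleftrightarrow> L N > 0"
proof -
  note pos = positivity[OF assms]
  let ?A = "(sin N)\<^sup>2 * (cos (M N) + cos N)"
  let ?B = "(sin ((h - k + N) / 2))\<^sup>2 * (cos (h + k) + cos N)"
  have cc: "cos (M N) + cos N > 0" using pos by simp
  have "L N = ln ?A - ln ?B"
    using pos cc by (simp add: L_def ln_mult ln_realpow)
  moreover have "?A > 0" "?B > 0" using pos cc by auto
  ultimately show "g N = 0 \<longleftrightarrow> L N = 0" "g N > 0 \<longleftrightarrow> L N > 0"
    unfolding g_def by auto
qed

lemma g_zero_unique:
  assumes "0 < N1" "N1 < h - k" "N1 \<le> k" "g N1 = 0" "0 < N2" "N2 < h - k" "N2 \<le> k" "g N2 = 0"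
  shows "N1 = N2"
  using assms g_L(1) L_strict_mono by (metis less_irrefl linorder_neqE_linordered_idom)

lemma g_k_pos:
  assumes "0 < N" "N < k" "k < h - k" "g N = 0"
  shows "g k > 0"
  using L_strict_mono[of N k] assms g_L(1)[of N] g_L(2)[of k] k_pos by simp

section \<open>Endpoint values and existence of a zero\<close>

lemma M_k:
  assumes "k < h - k"
  shows "M k = k"
proof -
  have eq: "(h - k) / 2 + k = (h + k) / 2" unfolding add_divide_distrib diff_divide_distrib by simp
  have "M k = 2 * arctan (tan (k / 2))"
    unfolding M_def eq using T_pos by simp
  also have "\<dots> = k" using k_pos k_less_h h_le by (subst arctan_tan) auto
  finally show ?thesis .
qed

text \<open>\<open>M k = k\<close> allows a closed form. The last bracket is, up to the factor
  \<open>4 cos (h/2)\<close>, the difference of the two sides of the inequality in the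
  theorem.\<close>

lemma g_k:
  assumes "k < h - k"
  shows "g k = 2 * sin (k + h / 2) * (cos k * sin (k - h / 2) + sin (h / 2) ^ 3)"
proof -
  define f where "f = h / 2"
  have "cos (h + k) + cos k = 2 * cos (f + k) * cos f"
    using cos_plus_cos[of "h + k" k] by (simp add: f_def add_divide_distrib add.commute)
  then have gk: "g k = 2 * ((sin k)\<^sup>2 * cos k - (sin f)\<^sup>2 * cos (f + k) * cos f)"
    by (simp add: g_def M_k[OF assms] f_def algebra_simps)
  have prod: "sin (k + f) * sin (k - f) = (sin k)\<^sup>2 - (sin f)\<^sup>2"
    by (rule sin_add_times_sin_diff)
  have "2 * sin (k + f) * (cos k * sin (k - f) + sin f ^ 3)
      = 2 * (cos k * (sin (k + f) * sin (k - f)) + (sin f)\<^sup>2 * (sin f * sin (k + f)))"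
    by (simp add: algebra_simps power2_eq_square power3_eq_cube)
  also have "sin f * sin (k + f) = cos k - cos f * cos (f + k)"
    using cos_diff[of "k + f" f] by (simp add: add.commute)
  finally show ?thesis
    unfolding gk prod f_def[symmetric] by (simp add: algebra_simps)
qed

lemma continuous_on_g:
  assumes "b \<le> h - k" "b \<le> k"
  shows "continuous_on {0..b} g"
proof -
  have "cos ((h - k) / 2 + N) \<noteq> 0" "tan ((h - k) / 2 + N) \<noteq> 0" "cos (N / 2) \<noteq> 0" if "N \<in> {0..b}" for N
    using arg_bounds[of N] that assms k_pos k_less_h h_le
      cos_gt_zero[of "(h - k) / 2 + N"] cos_gt_zero_pi[of "N / 2"] by auto
  then show ?thesis
    unfolding g_def M_def by (intro continuous_intros) auto
qed

lemma exists_zero: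
  assumes "h - k \<le> k \<or> g k > 0"
  shows "\<exists>N. 0 < N \<and> N < h - k \<and> N < k \<and> g N = 0"
proof -
  define b where "b = min (h - k) k"
  have b: "0 < b" "b \<le> h - k" "b \<le> k" using k_pos k_less_h by (auto simp: b_def)
  have g0: "g 0 < 0"
  proof -
    have "sin ((h - k) / 2) > 0" using k_pos k_less_h h_le by (intro sin_gt_zero) auto
    moreover have "cos (h + k) + 1 > 0"
      using cos_monotone_0_pi[of "h + k" pi] k_pos k_less_h h_le by simp
    ultimately show ?thesis by (simp add: g_def)
  qed
  have gb: "g b > 0"
  proof (cases "h - k \<le> k")
    case True
    \<comment> \<open>At this endpoint the two sines in \<open>g\<close> coincide, so the sign is
      decided by \<open>cos (h + k) < cos M\<close>.\<close>
    then have "b = h - k" by (simp add: b_def)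
    have "sin (h - k) > 0" using k_pos k_less_h h_le by (intro sin_gt_zero) auto
    moreover have eq: "(h - k + (h - k)) / 2 = h - k" by (simp only: mult_2[symmetric]) simp
    moreover have "cos (h + k) < cos (M (h - k))"
      using cos_M_gt[of b] b \<open>b = h - k\<close> by simp
    ultimately show ?thesis
      unfolding g_def \<open>b = h - k\<close> eq by (simp add: mult_strict_left_mono)
  next
    case False
    then show ?thesis using assms by (simp add: b_def)
  qed
  have "\<exists>N\<ge>0. N \<le> b \<and> g N = 0"
    using g0 gb b continuous_on_g by (intro IVT') auto
  then obtain N where N: "0 \<le> N" "N \<le> b" "g N = 0" by auto
  then have "N \<noteq> 0" "N \<noteq> b" using g0 gb by auto
  then show ?thesis using N b by (intro exI[of _ N]) auto
qed

end

section \<open>Trigonometric identities in sum and difference of p and q\<close>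

lemma sine_difference_product:
  fixes h p q :: real
  shows "sin q * sin h - sin p * sin (h + (q - p)) = sin (h - p) * sin (q - p)"
proof -
  have "cos (p - (h + (q - p))) = cos (h - p + (q - p))"
    using cos_minus[of "h - p + (q - p)"] by (simp add: algebra_simps)
  moreover have "cos (h - p - (q - p)) = cos (q - h)"
    using cos_minus[of "q - h"] by simp
  ultimately show ?thesis
    by (simp add: sin_times_sin add.commute diff_divide_distrib)
qed

text \<open>Multiplication by \<open>(sin (q - p))\<^sup>2\<close> lets each of
  \<open>sin (h - p)\<close> and \<open>sin (k - q)\<close> absorb one factor; by the hypothesis
  each product is then \<open>sin q\<close> or \<open>sin p\<close> times a difference of two sines.
  Apart from the prefactor, only \<open>q - p\<close> and \<open>p + q\<close> survive.\<close>

lemma sine_product_defect: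
  fixes h k p q :: real
  assumes "sin q * sin (k - (q - p)) = sin p * sin (h + (q - p))"
  shows "(sin (h - p) * sin (k - q) - sin (2 * p) * sin (2 * q)) * (sin (q - p))\<^sup>2
    = 2 * sin p * sin q * ((sin ((h - k + (q - p)) / 2))\<^sup>2 * (cos (h + k) + cos (q - p))
        - (sin (q - p))\<^sup>2 * (cos (p + q) + cos (q - p)))"
proof -
  define N where "N = q - p"
  define d where "d = sin ((h - k + N) / 2)"
  have E: "sin q * sin (k - N) = sin p * sin (h + N)" using assms by (simp add: N_def)
  have 1: "sin (h - p) * sin N = sin q * (sin h - sin (k - N))"
    using sine_difference_product[of q h p] E by (simp add: N_def right_diff_distrib)
  have 2: "sin (k - q) * sin N = sin p * (sin (h + N) - sin k)"
  proof -
    have "sin p * sin k - sin q * sin (k - N) = - (sin (k - q) * sin N)"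
    proof -
      have "k + (p - q) = k - (q - p)" "p - q = - (q - p)" by auto
      then show ?thesis
        using sine_difference_product[of p k q] by (simp only: N_def sin_minus mult_minus_right)
    qed
    then show ?thesis using E by (simp add: right_diff_distrib)
  qed
  have 3: "sin h - sin (k - N) = 2 * d * cos ((h + k - N) / 2)"
  proof -
    have "h - (k - N) = h - k + N" "h + (k - N) = h + k - N" by auto
    then show ?thesis by (simp only: sin_diff_sin d_def mult.assoc)
  qed
  have 4: "sin (h + N) - sin k = 2 * d * cos ((h + k + N) / 2)"
    by (simp add: sin_diff_sin d_def algebra_simps)
  have 5: "cos (h + k) + cos N = 2 * cos ((h + k + N) / 2) * cos ((h + k - N) / 2)"
    by (simp add: cos_plus_cos)
  have 6: "cos (p + q) + cos N = 2 * (cos p * cos q)"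
    by (simp add: N_def cos_add cos_diff)
  have "(sin (h - p) * sin (k - q) - sin (2 * p) * sin (2 * q)) * (sin N)\<^sup>2
      = (sin (h - p) * sin N) * (sin (k - q) * sin N) - sin (2 * p) * sin (2 * q) * (sin N)\<^sup>2"
    by (simp add: algebra_simps power2_eq_square)
  also have "\<dots> = sin q * (2 * d * cos ((h + k - N) / 2)) * (sin p * (2 * d * cos ((h + k + N) / 2)))
      - 4 * sin p * cos p * sin q * cos q * (sin N)\<^sup>2"
    unfolding 1 2 3 4 sin_double by simp
  also have "\<dots> = 2 * sin p * sin q * (d\<^sup>2 * (2 * cos ((h + k + N) / 2) * cos ((h + k - N) / 2))
      - (sin N)\<^sup>2 * (2 * (cos p * cos q)))"
    by (simp add: algebra_simps power2_eq_square)
  finally show ?thesis by (simp only: 5[unfolded N_def] 6[unfolded N_def] d_def N_def)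
qed

text \<open>With \<open>A = (p + q) / 2\<close> and \<open>B = (q - p) / 2\<close>, division by the
  cosines turns the right side into the tangent equation that defines \<open>M\<close>.\<close>

lemma sine_relation_iff_half_angles:
  fixes A B h k :: real
  shows "sin (A + B) * sin (k - 2 * B) = sin (A - B) * sin (h + 2 * B) \<longleftrightarrow>
    sin A * cos B * (cos ((h + k) / 2) * sin ((h - k) / 2 + 2 * B))
      = cos A * sin B * (sin ((h + k) / 2) * cos ((h - k) / 2 + 2 * B))"
proof -
  have h: "(h + 2 * B - (k - 2 * B)) / 2 = (h - k) / 2 + 2 * B"
    by (simp add: field_simps)
  have d: "sin (h + 2 * B) - sin (k - 2 * B) = 2 * (cos ((h + k) / 2) * sin ((h - k) / 2 + 2 * B))"
    using sin_diff_sin[of "h + 2 * B" "k - 2 * B"] unfolding h by simp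
  have s: "sin (h + 2 * B) + sin (k - 2 * B) = 2 * (sin ((h + k) / 2) * cos ((h - k) / 2 + 2 * B))"
    using sin_plus_sin[of "h + 2 * B" "k - 2 * B"] unfolding h by simp
  have "sin (A - B) * sin (h + 2 * B) - sin (A + B) * sin (k - 2 * B)
    = sin A * cos B * (sin (h + 2 * B) - sin (k - 2 * B)) - cos A * sin B * (sin (h + 2 * B) + sin (k - 2 * B))"
    by (simp add: sin_add[of A] sin_diff[of A] algebra_simps)
  also have "\<dots> = 2 * (sin A * cos B * (cos ((h + k) / 2) * sin ((h - k) / 2 + 2 * B))
      - cos A * sin B * (sin ((h + k) / 2) * cos ((h - k) / 2 + 2 * B)))"
    unfolding d s by (simp add: algebra_simps)
  finally show ?thesis by auto
qed

section \<open>Correspondence between the sine relations and zeros of g\<close>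

context angle_pair
begin

text \<open>The relations alone must locate \<open>N = q - p\<close>. Since
  \<open>p + q < h + k\<close>, they imply that \<open>sin N\<close> is smaller in absolute value
  than \<open>sin ((h - k + N) / 2)\<close>, which bounds \<open>N\<close> above; monotonicity of
  sine on both sides of \<open>rel\<close> excludes \<open>N \<le> 0\<close>.\<close>

lemma zero_of_sine_relations:
  assumes pos: "0 < p" "p < h" "0 < q" "q < k"
    and prod: "sin (h - p) * sin (k - q) = sin (2 * p) * sin (2 * q)"
    and rel: "sin q * sin (k - (q - p)) = sin p * sin (h + (q - p))"
  shows "0 < q - p" "q - p < h - k" "q - p < k" "p + q = M (q - p)" "g (q - p) = 0"
proof -
  define N where "N = q - p"
  define m where "m = p + q"
  have bounds: "- (pi / 2) < N" "N < pi / 2" "0 < m" "m < h + k" "h + k < pi"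
    using pos k_less_h h_le by (auto simp: N_def m_def)
  have trig_pos: "sin p > 0" "sin q > 0" "cos p > 0" "cos q > 0"
    using pos k_less_h h_le by (auto intro!: sin_gt_zero cos_gt_zero)
  have "N \<noteq> 0"
  proof
    assume "N = 0"
    then have "sin k = sin h" using rel trig_pos by (simp add: N_def)
    then show False using sin_monotone_2pi[of k h] k_pos k_less_h h_le by simp
  qed
  then have "sin N \<noteq> 0"
    using bounds sin_gt_zero[of N] sin_gt_zero[of "- N"] by (cases "N > 0") auto
  have eq: "(sin N)\<^sup>2 * (cos m + cos N) = (sin ((h - k + N) / 2))\<^sup>2 * (cos (h + k) + cos N)"
    using sine_product_defect[OF rel] prod trig_pos by (simp add: N_def m_def)
  have "cos m + cos N = 2 * (cos p * cos q)"
    by (simp add: N_def m_def cos_add cos_diff)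
  then have cc: "cos m + cos N > 0" using trig_pos by simp
  then have "(sin ((h - k + N) / 2))\<^sup>2 * (cos (h + k) + cos N) > 0"
    using \<open>sin N \<noteq> 0\<close> unfolding eq[symmetric] by simp
  then have ch: "cos (h + k) + cos N > 0"
    by (meson not_less mult_nonneg_nonpos zero_le_power2)
  have "cos (h + k) < cos m"
    using bounds by (intro cos_monotone_0_pi) auto
  then have "(sin N)\<^sup>2 * (cos (h + k) + cos N) < (sin N)\<^sup>2 * (cos m + cos N)"
    using \<open>sin N \<noteq> 0\<close> by simp
  then have sq: "(sin N)\<^sup>2 < (sin ((h - k + N) / 2))\<^sup>2"
    using ch unfolding eq by simp
  have "N > 0"
  proof (rule ccontr)
    assume "\<not> N > 0"
    then have "N < 0" using \<open>N \<noteq> 0\<close> by simp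
    define w where "w = (h - k + N) / 2"
    have *: "- N < \<bar>w\<bar>"
    proof (rule ccontr)
      assume "\<not> - N < \<bar>w\<bar>"
      then have "sin \<bar>w\<bar> \<le> sin (- N)"
        using bounds by (intro sin_monotone_2pi_le) auto
      moreover have "0 \<le> sin \<bar>w\<bar>"
        using \<open>\<not> - N < \<bar>w\<bar>\<close> bounds by (intro sin_ge_zero) auto
      ultimately have "(sin \<bar>w\<bar>)\<^sup>2 \<le> (sin (- N))\<^sup>2" by (rule power_mono)
      moreover have "(sin \<bar>w\<bar>)\<^sup>2 = (sin w)\<^sup>2" by (simp add: abs_if)
      ultimately show False using sq by (simp add: w_def[symmetric])
    qed
    then have "k - N < h + N" using \<open>N < 0\<close> k_less_h by (auto simp: w_def abs_if split: if_splits)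
    then have "sin (k - N) \<le> sin (h + N)"
      using bounds \<open>N < 0\<close> k_pos h_le by (intro sin_monotone_2pi_le) auto
    moreover have "0 < sin (h + N)"
      using pos \<open>N < 0\<close> h_le by (intro sin_gt_zero) (auto simp: N_def)
    moreover have "sin q < sin p"
      using pos \<open>N < 0\<close> h_le by (intro sin_monotone_2pi) (auto simp: N_def)
    ultimately have "sin q * sin (k - N) < sin p * sin (h + N)"
      using trig_pos by (meson mult_left_mono mult_strict_right_mono less_imp_le le_less_trans)
    then show False using rel by (simp add: N_def)
  qed
  moreover have "N < h - k"
  proof (rule ccontr)
    assume "\<not> N < h - k"
    then have "sin ((h - k + N) / 2) \<le> sin N"
      using bounds \<open>N > 0\<close> k_less_h by (intro sin_monotone_2pi_le) auto
    moreover have "0 \<le> sin ((h - k + N) / 2)"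
      using \<open>\<not> N < h - k\<close> bounds \<open>N > 0\<close> k_less_h by (intro sin_ge_zero) auto
    ultimately show False using sq by (meson not_less power_mono)
  qed
  moreover have "N < k" using pos by (simp add: N_def)
  moreover have "m = M N"
  proof -
    note b = arg_bounds[of N]
    have half: "0 < m / 2" "m / 2 < pi / 2" "0 < N / 2" "N / 2 < pi / 2" "0 < (h + k) / 2" "(h + k) / 2 < pi / 2"
      using bounds \<open>N > 0\<close> by auto
    have arg: "0 < (h - k) / 2 + N" "(h - k) / 2 + N < pi / 2"
      using b(1,2) \<open>N > 0\<close> \<open>N < h - k\<close> \<open>N < k\<close> by auto
    have cpos: "cos (m / 2) > 0" "cos (N / 2) > 0" "cos ((h + k) / 2) > 0" "cos ((h - k) / 2 + N) > 0"
      "sin ((h - k) / 2 + N) > 0"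
      using cos_gt_zero[OF half(1,2)] cos_gt_zero[OF half(3,4)] cos_gt_zero[OF half(5,6)]
        cos_gt_zero[OF arg] sin_gt_zero2[OF arg] by auto
    have "q = m / 2 + N / 2" "p = m / 2 - N / 2" "N = 2 * (N / 2)"
      by (simp_all add: m_def N_def field_simps)
    then have "sin (m / 2) * cos (N / 2) * (cos ((h + k) / 2) * sin ((h - k) / 2 + N))
      = cos (m / 2) * sin (N / 2) * (sin ((h + k) / 2) * cos ((h - k) / 2 + N))"
      using rel sine_relation_iff_half_angles[of "m / 2" "N / 2" k h] by (simp add: N_def[symmetric])
    then have "tan (m / 2) = tan ((h + k) / 2) * tan (N / 2) / tan ((h - k) / 2 + N)"
      using cpos by (simp add: tan_def divide_simps mult_ac)
    then have "M N = 2 * arctan (tan (m / 2))" by (simp add: M_def)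
    also have "\<dots> = m" using bounds by (subst arctan_tan) auto
    finally show ?thesis by simp
  qed
  ultimately show "0 < q - p" "q - p < h - k" "q - p < k" "p + q = M (q - p)" "g (q - p) = 0"
    using eq by (auto simp: N_def m_def g_def)
qed

text \<open>The last bound comes from \<open>sin (M - S) sin (M + S) = sin (N - d) sin (N + d) < 0\<close> with
  \<open>S = (\<alpha>1 + \<beta>1)/2\<close> and \<open>d = (\<alpha>1 - \<beta>1)/2\<close>, which is a rewriting of the product relation.\<close>

lemma sine_relations_of_zero:
  assumes N: "0 < N" "N < h - k" "N < k" "g N = 0"
  defines "p \<equiv> (M N - N) / 2" and "q \<equiv> (M N + N) / 2"
  shows "0 < p" "p < h" "0 < q" "q < k"
    and "sin (h - p) * sin (k - q) = sin (2 * p) * sin (2 * q)"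
    and "sin q * sin (k - N) = sin p * sin (h + N)"
    and "3 * M N < h + k"
proof -
  define m where "m = M N"
  have m: "0 < m" "m < h + k" "h + k < pi" "m \<le> pi / 2"
    using M_pos[of N] M_less_sum[of N] M_le_pi_half[of N] N k_less_h h_le by (auto simp: m_def)
  have pq: "q - p = N" "p + q = m" by (simp_all add: p_def q_def m_def field_simps)
  have half: "0 < m / 2" "m / 2 < pi / 2" "0 < N / 2" "N / 2 < pi / 2" "0 < (h + k) / 2" "(h + k) / 2 < pi / 2"
    using m N k_pos k_less_h h_le by auto
  have arg: "0 < (h - k) / 2 + N" "(h - k) / 2 + N < pi / 2" "(h - k) / 2 + N < (h + k) / 2"
    using arg_bounds(1,2)[of N] N unfolding add_divide_distrib diff_divide_distrib by auto
  have cpos: "cos (m / 2) > 0" "cos (N / 2) > 0" "cos ((h + k) / 2) > 0" "cos ((h - k) / 2 + N) > 0"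
    "sin ((h - k) / 2 + N) > 0"
    using cos_gt_zero[OF half(1,2)] cos_gt_zero[OF half(3,4)] cos_gt_zero[OF half(5,6)]
      cos_gt_zero[OF arg(1,2)] sin_gt_zero2[OF arg(1,2)] by auto
  have tan_m: "tan (m / 2) = tan ((h + k) / 2) * tan (N / 2) / tan ((h - k) / 2 + N)"
    using tan_half_M by (simp add: m_def)
  \<comment> \<open>This makes \<open>p\<close> positive. As \<open>N < k\<close>, the angle
    \<open>(h - k) / 2 + N\<close> lies below \<open>(h + k) / 2\<close>, so the tangent quotient
    exceeds \<open>tan (N / 2)\<close>.\<close>
  have "N < m"
  proof -
    have "tan ((h - k) / 2 + N) < tan ((h + k) / 2)"
      using arg half by (intro tan_monotone) auto
    moreover have "tan (N / 2) > 0" "tan ((h - k) / 2 + N) > 0"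
      using half arg by (auto intro: tan_gt_zero)
    ultimately have "tan (N / 2) < tan (m / 2)"
      unfolding tan_m by (simp add: field_simps)
    then have "arctan (tan (N / 2)) < arctan (tan (m / 2))" by (rule arctan_monotone)
    then show ?thesis using half by (simp add: arctan_tan)
  qed
  show "0 < p" "0 < q" using \<open>N < m\<close> N m by (auto simp: p_def q_def m_def)
  have "p < pi / 2" "q < pi" using m pq \<open>0 < p\<close> \<open>0 < q\<close> by auto
  then have sin_pos: "sin p > 0" "sin q > 0" "sin N > 0"
    using \<open>0 < p\<close> \<open>0 < q\<close> N k_less_h h_le by (auto intro!: sin_gt_zero)
  have qp: "q = m / 2 + N / 2" "p = m / 2 - N / 2" by (simp_all add: p_def q_def m_def field_simps)
  show rel: "sin q * sin (k - N) = sin p * sin (h + N)"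
  proof -
    have "sin (m / 2) * cos (N / 2) * (cos ((h + k) / 2) * sin ((h - k) / 2 + N))
      = cos (m / 2) * sin (N / 2) * (sin ((h + k) / 2) * cos ((h - k) / 2 + N))"
      using tan_m cpos by (simp add: tan_def divide_simps mult_ac)
    then show ?thesis
      using sine_relation_iff_half_angles[of "m / 2" "N / 2" k h] by (simp add: qp)
  qed
  have rel': "sin q * sin (k - (q - p)) = sin p * sin (h + (q - p))" using rel pq by simp
  have "(sin N)\<^sup>2 * (cos m + cos N) = (sin ((h - k + N) / 2))\<^sup>2 * (cos (h + k) + cos N)"
    using N by (simp add: g_def m_def)
  then show E1: "sin (h - p) * sin (k - q) = sin (2 * p) * sin (2 * q)"
    using sine_product_defect[OF rel'] sin_pos by (simp add: pq)
  show "p < h"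
  proof -
    have "sin (k - N) < sin h"
      using N k_pos k_less_h h_le by (intro sin_monotone_2pi) auto
    moreover have "sin (h - p) * sin N = sin q * (sin h - sin (k - N))"
      using sine_difference_product[of q h p] rel by (simp add: pq right_diff_distrib)
    ultimately have "sin (h - p) > 0"
      using sin_pos by (metis diff_gt_0_iff_gt mult_pos_pos zero_less_mult_pos2)
    then show ?thesis
      using sin_ge_zero[of "p - h"] sin_minus[of "p - h"] \<open>p < pi / 2\<close> k_pos k_less_h by force
  qed
  show "q < k"
  proof -
    have "sin (h + N) - sin k = 2 * (sin ((h - k + N) / 2) * cos ((h + k + N) / 2))"
      by (simp add: sin_diff_sin algebra_simps)
    moreover have "sin ((h - k + N) / 2) > 0" "cos ((h + k + N) / 2) > 0"
      using N k_pos k_less_h h_le by (auto intro!: sin_gt_zero cos_gt_zero)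
    ultimately have "sin (h + N) - sin k > 0" by simp
    moreover have "sin (k - q) * sin N = sin p * (sin (h + N) - sin k)"
    proof -
      have "k + (p - q) = k - N" "p - q = - N" using pq by auto
      then have "sin p * sin k - sin q * sin (k - N) = - (sin (k - q) * sin N)"
        using sine_difference_product[of p k q] by (simp only: sin_minus mult_minus_right)
      then show ?thesis using rel by (simp add: right_diff_distrib)
    qed
    ultimately have "sin (k - q) > 0"
      using sin_pos by (metis mult_pos_pos zero_less_mult_pos2)
    then show ?thesis
      using sin_ge_zero[of "q - k"] sin_minus[of "q - k"] \<open>q < pi\<close> k_pos by force
  qed
  show "3 * M N < h + k"
  proof (rule ccontr)
    assume "\<not> 3 * M N < h + k"
    define S d where "S = (h + k - m) / 2" and "d = (h - k + N) / 2"
    have Sd: "h - p = S + d" "k - q = S - d" "q + q = m + N" "p + p = m - N"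
      by (simp_all add: S_def d_def p_def q_def m_def field_simps)
    have sm: "sin (m - S) * sin (m + S) = (sin m)\<^sup>2 - (sin S)\<^sup>2"
      and sn: "sin (N - d) * sin (N + d) = (sin N)\<^sup>2 - (sin d)\<^sup>2"
      and sd: "sin (S + d) * sin (S - d) = (sin S)\<^sup>2 - (sin d)\<^sup>2"
      and mn: "sin (m - N) * sin (m + N) = (sin m)\<^sup>2 - (sin N)\<^sup>2"
      using sin_add_times_sin_diff[of m S] sin_add_times_sin_diff[of N d]
        sin_add_times_sin_diff[of S d] sin_add_times_sin_diff[of m N] by (simp_all add: mult.commute)
    have "(sin S)\<^sup>2 - (sin d)\<^sup>2 = (sin m)\<^sup>2 - (sin N)\<^sup>2"
      using E1 unfolding Sd mult_2 sd mn .
    then have 1: "sin (m - S) * sin (m + S) = sin (N - d) * sin (N + d)"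
      unfolding sm sn by simp
    have "2 * S = h + k - m" "2 * d = h - k + N" by (simp_all add: S_def d_def)
    then have S: "0 < S" "S \<le> m" "m + S < pi" and d: "N < d" "d < pi / 2" "N + d < pi"
      using \<open>\<not> 3 * M N < h + k\<close> m N k_pos k_less_h h_le unfolding m_def[symmetric] by linarith+
    have "sin (N - d) < 0" using sin_gt_zero[of "d - N"] sin_minus[of "d - N"] d N by simp
    moreover have "sin (N + d) > 0" "sin (m + S) > 0" "sin S > 0" "sin d > 0"
      using d S m N by (auto intro!: sin_gt_zero)
    ultimately have "sin (m - S) * sin (m + S) < 0" unfolding 1 by (simp add: mult_neg_pos)
    moreover have "sin (m - S) \<ge> 0" using S m by (intro sin_ge_zero) auto
    ultimately show False using \<open>sin (m + S) > 0\<close> by (simp add: mult_less_0_iff)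
  qed
qed

end

text \<open>Displays the sign: \<open>B00\<close> is negative once both cosine sums are
  positive.\<close>

lemma B00_factorization:
  "B00 \<alpha>1 \<alpha>2 \<beta>1 = - ((cos (\<alpha>1 + \<alpha>2) + cos \<beta>1) * (cos (\<alpha>1 - \<alpha>2) + cos \<beta>1))"
proof -
  have "cos (\<alpha>1 + \<alpha>2) * cos (\<alpha>1 - \<alpha>2) = (cos \<alpha>1)\<^sup>2 * (cos \<alpha>2)\<^sup>2 - (sin \<alpha>1)\<^sup>2 * (sin \<alpha>2)\<^sup>2"
    by (simp add: cos_add cos_diff algebra_simps power2_eq_square)
  then have "cos (\<alpha>1 + \<alpha>2) * cos (\<alpha>1 - \<alpha>2) = (cos \<alpha>1)\<^sup>2 + (cos \<alpha>2)\<^sup>2 - 1"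
    by (simp add: sin_squared_eq algebra_simps)
  moreover have "cos (\<alpha>1 + \<alpha>2) + cos (\<alpha>1 - \<alpha>2) = 2 * cos \<alpha>1 * cos \<alpha>2"
    by (simp add: cos_add cos_diff)
  moreover have "(cos (\<alpha>1 + \<alpha>2) + cos \<beta>1) * (cos (\<alpha>1 - \<alpha>2) + cos \<beta>1)
    = cos (\<alpha>1 + \<alpha>2) * cos (\<alpha>1 - \<alpha>2) + (cos (\<alpha>1 + \<alpha>2) + cos (\<alpha>1 - \<alpha>2)) * cos \<beta>1 + (cos \<beta>1)\<^sup>2"
    by (simp add: algebra_simps power2_eq_square)
  ultimately show ?thesis unfolding B00_def by simp
qed

lemma ex1_image_iff:
  assumes "inj F"
  shows "(\<exists>!t. \<exists>s. t = F s \<and> P s) \<longleftrightarrow> (\<exists>!s. P s)"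
proof
  assume unique: "\<exists>!t. \<exists>s. t = F s \<and> P s"
  then obtain s where "P s" by auto
  show "\<exists>!s. P s"
  proof (rule ex1I)
    show "P s" by fact
    fix s' assume "P s'"
    then have "F s' = F s" using unique \<open>P s\<close> by auto
    then show "s' = s" by (rule injD[OF assms])
  qed
qed blast

section \<open>From the sine relations to proper solutions\<close>

context angle_pair
begin

lemma proper_of_sine_relations:
  assumes pos: "0 < p" "p < h" "0 < q" "q < k" "p < q"
    and prod: "sin (h - p) * sin (k - q) = sin (2 * p) * sin (2 * q)"
    and rel: "sin q * sin (k - (q - p)) = sin p * sin (h + (q - p))"
    and small: "3 * (p + q) < h + k"
  shows "edge_conditions (h - p) (2 * p) (k - q) (2 * q)"
    and "proper (h - p) (2 * p) (k - q) (2 * q)"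
proof -
  define \<alpha> \<beta> where "\<alpha> = h - p" and "\<beta> = k - q"
  have hk: "h + k < pi" "h \<le> pi / 2" "k < pi / 2" using k_less_h h_le by auto
  have bounds: "0 < \<alpha>" "\<alpha> < pi / 2" "0 < \<beta>" "\<beta> < pi / 2" "6 * p < pi" "q < pi / 2" "p < pi / 2"
    "\<alpha> + p \<le> pi / 2" "\<beta> + q < pi / 2"
    using pos small hk by (auto simp: \<alpha>_def \<beta>_def)
  have trig_pos: "sin \<alpha> > 0" "sin \<beta> > 0" "cos \<alpha> > 0" "cos \<beta> > 0"
    "sin p > 0" "cos p > 0" "sin q > 0" "cos q > 0"
    using pos bounds by (auto intro!: sin_gt_zero2 cos_gt_zero)
  have sin_eqD: "s = t" if "sin s = sin t" "0 < s" "s \<le> pi / 2" "0 < t" "t \<le> pi / 2" for s t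
    using that sin_monotone_2pi[of s t] sin_monotone_2pi[of t s] by (cases s t rule: linorder_cases) auto
  have prod_\<alpha>\<beta>: "sin \<alpha> * sin \<beta> = sin (2 * p) * sin (2 * q)"
    using prod by (simp add: \<alpha>_def \<beta>_def)
  then have prod': "sin \<alpha> * sin \<beta> = 4 * sin p * cos p * sin q * cos q"
    using prod_\<alpha>\<beta> by (simp add: sin_double)
  have rel_ab: "sin q * sin (p + \<beta>) = sin p * sin (q + \<alpha>)"
  proof -
    have eqs: "k - (q - p) = p + \<beta>" "h + (q - p) = q + \<alpha>" by (auto simp: \<alpha>_def \<beta>_def)
    show ?thesis using rel unfolding eqs .
  qed
  \<comment> \<open>The quartic identity carries a factor \<open>r - 1\<close>, which must be nonzero to be cancelled.\<close>
  have ne: "sin \<beta> \<noteq> 2 * sin p * cos p"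
  proof
    assume eq: "sin \<beta> = 2 * sin p * cos p"
    have "\<beta> = 2 * p" by (rule sin_eqD) (use eq bounds pos in \<open>auto simp: sin_double\<close>)
    have "(2 * sin p * cos p) * sin \<alpha> = (2 * sin p * cos p) * sin (2 * q)"
      using prod' unfolding eq sin_double by (simp add: mult_ac)
    then have sin_\<alpha>: "sin \<alpha> = sin (2 * q)" using trig_pos by simp
    \<comment> \<open>Either \<open>\<alpha> = 2 * q\<close>, and then
      \<open>h + k = 3 * (p + q)\<close> against \<open>small\<close>; or
      \<open>\<alpha> = pi - 2 * q\<close>, and then \<open>rel_ab\<close> gives
      \<open>sin (3 * p) = sin p\<close> although \<open>6 * p < pi\<close>.\<close>
    show False
    proof (cases "2 * q \<le> pi / 2")
      case True
      then have "\<alpha> = 2 * q" by (intro sin_eqD[OF sin_\<alpha>]) (use bounds pos in auto)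
      then show False using \<open>\<beta> = 2 * p\<close> small by (simp add: \<alpha>_def \<beta>_def)
    next
      case False
      have "sin \<alpha> = sin (pi - 2 * q)" using sin_\<alpha> by simp
      then have "\<alpha> = pi - 2 * q" by (rule sin_eqD) (use False bounds pos in auto)
      then have "q + \<alpha> = pi - q" by simp
      then have "sin (q + \<alpha>) = sin q" by (simp only: sin_pi_minus)
      then have "sin (3 * p) = sin p"
        using rel_ab \<open>\<beta> = 2 * p\<close> trig_pos by simp
      then show False using sin_monotone_2pi[of p "3 * p"] bounds pos by simp
    qed
  qed
  have f1: "B00 \<alpha> (2 * p) \<beta> * (sin \<beta>)\<^sup>2 = B11 \<alpha> \<beta> (2 * q) * (sin (2 * p))\<^sup>2"
    unfolding B00_def B11_def sin_double[of p]
  proof (rule edge_algebra.edge_condition_if_sine_relation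
      [OF edge_algebra_of_sine_product[OF trig_pos prod_\<alpha>\<beta>] _ ne])
    show "sin q * (sin p * cos \<beta> + cos p * sin \<beta>) = sin p * (sin q * cos \<alpha> + cos q * sin \<alpha>)"
      using rel_ab by (simp add: sin_add)
  qed
  \<comment> \<open>The second edge condition, multiplied by \<open>(sin \<beta>)\<^sup>2\<close>,
    follows from the first by the product relation.\<close>
  have "(B11 \<alpha> \<beta> (2 * q) * (sin \<alpha>)\<^sup>2) * (sin \<beta>)\<^sup>2 = B11 \<alpha> \<beta> (2 * q) * (sin \<alpha> * sin \<beta>)\<^sup>2"
    by (simp add: power_mult_distrib)
  also have "\<dots> = (B11 \<alpha> \<beta> (2 * q) * (sin (2 * p))\<^sup>2) * (sin (2 * q))\<^sup>2"
    using prod_\<alpha>\<beta> by (simp add: power_mult_distrib)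
  also have "\<dots> = (B00 \<alpha> (2 * p) \<beta> * (sin (2 * q))\<^sup>2) * (sin \<beta>)\<^sup>2"
    unfolding f1[symmetric] by simp
  finally have f2: "B11 \<alpha> \<beta> (2 * q) * (sin \<alpha>)\<^sup>2 = B00 \<alpha> (2 * p) \<beta> * (sin (2 * q))\<^sup>2"
    using trig_pos by simp
  show "edge_conditions (h - p) (2 * p) (k - q) (2 * q)"
    using f1 f2 by (simp add: edge_conditions_def f1_def f2_def \<alpha>_def \<beta>_def)
  have "cos (\<alpha> + 2 * p) > - cos \<beta>"
  proof -
    have "cos (pi - \<beta>) < cos (\<alpha> + 2 * p)"
      using bounds pos hk by (intro cos_monotone_0_pi) (auto simp: \<alpha>_def \<beta>_def)
    then show ?thesis by simp
  qed
  moreover have "cos (\<alpha> - 2 * p) > 0"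
    using bounds pos by (intro cos_gt_zero_pi) auto
  ultimately have B00_neg: "B00 \<alpha> (2 * p) \<beta> < 0"
    unfolding B00_factorization using trig_pos by simp
  have "B11 \<alpha> \<beta> (2 * q) * (sin (2 * p))\<^sup>2 < 0"
    unfolding f1[symmetric] using B00_neg trig_pos by (simp add: mult_neg_pos)
  then have B11_neg: "B11 \<alpha> \<beta> (2 * q) < 0"
    by (simp add: mult_less_0_iff)
  \<comment> \<open>\<open>small\<close> gives \<open>p + q < pi / 3\<close>, hence
    \<open>2 cos p cos q > 1\<close>, whereas two positive cosines differ by at most 1.\<close>
  have Dm: "(1 + cos (2 * p)) * (1 + cos (2 * q)) > (cos \<alpha> - cos \<beta>)\<^sup>2"
  proof -
    have "cos (pi / 3) < cos (p + q)" "cos (pi / 3) < cos (q - p)"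
      using pos small hk by (auto intro!: cos_monotone_0_pi)
    then have "1 < cos (p + q) + cos (q - p)" by (simp add: cos_60)
    also have "\<dots> = 2 * (cos p * cos q)" by (simp add: cos_add cos_diff)
    finally have "1 < 2 * (cos p * cos q)" .
    then have "1\<^sup>2 < (2 * (cos p * cos q))\<^sup>2" by (intro power_strict_mono) auto
    moreover have "(1 + cos (2 * p)) * (1 + cos (2 * q)) = (2 * (cos p * cos q))\<^sup>2"
      by (simp add: cos_double_cos power_mult_distrib)
    moreover have "\<bar>cos \<alpha> - cos \<beta>\<bar> \<le> 1"
      using trig_pos(3,4) cos_le_one[of \<alpha>] cos_le_one[of \<beta>] by linarith
    then have "(cos \<alpha> - cos \<beta>)\<^sup>2 \<le> 1" by (simp add: abs_square_le_1)
    ultimately show ?thesis by simp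
  qed
  have Dp: "(1 - cos (2 * p)) * (1 - cos (2 * q)) < (cos \<alpha> + cos \<beta>)\<^sup>2"
    using bounds pos by (intro first_det_factor_neg) auto
  have "det (coxeter_schlaefli \<alpha> (2 * p) \<beta> (2 * q)) < 0"
    unfolding det_coxeter_schlaefli using Dp Dm by (intro mult_neg_pos) auto
  then have "proper \<alpha> (2 * p) \<beta> (2 * q)"
    using bounds pos B00_neg B11_neg by (intro properI) auto
  then show "proper (h - p) (2 * p) (k - q) (2 * q)" by (simp add: \<alpha>_def \<beta>_def)
qed

section \<open>Existence and uniqueness, and the stated inequality\<close>

definition realises :: "real \<Rightarrow> real \<Rightarrow> bool" where
  "realises p q \<longleftrightarrow>
    edge_conditions (h - p) (2 * p) (k - q) (2 * q) \<and> proper (h - p) (2 * p) (k - q) (2 * q)"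

lemma zero_if_realises:
  assumes "realises p q"
  shows "0 < q - p" "q - p < h - k" "q - p < k" "p + q = M (q - p)" "g (q - p) = 0"
proof -
  have pos: "0 < p" "p < h" "0 < q" "q < k"
    using assms by (auto simp: realises_def proper_def)
  have "h - p + p \<le> pi / 2" "k - q + q < pi / 2" "h - p > 0" "k - q > 0"
    using pos k_less_h h_le by auto
  note rels = sine_relation_of_proper[OF this(3,4) pos(1,3) this(1,2)]
  have eqs: "p + (k - q) = k - (q - p)" "q + (h - p) = h + (q - p)" by auto
  show "0 < q - p" "q - p < h - k" "q - p < k" "p + q = M (q - p)" "g (q - p) = 0"
    using zero_of_sine_relations[OF pos rels[unfolded eqs]] assms by (auto simp: realises_def)
qed

lemma realises_if_zero:
  assumes "0 < N" "N < h - k" "N < k" "g N = 0"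
  shows "realises ((M N - N) / 2) ((M N + N) / 2)"
proof -
  define p q where "p = (M N - N) / 2" and "q = (M N + N) / 2"
  note rels = sine_relations_of_zero[OF assms, folded p_def q_def]
  have pq: "q - p = N" "p + q = M N" by (simp_all add: p_def q_def field_simps)
  have "p < q" using pq assms by simp
  then show ?thesis
    using proper_of_sine_relations[of p q] rels pq
    by (simp add: realises_def p_def[symmetric] q_def[symmetric])
qed

text \<open>If \<open>k < h - k\<close>, a realisation yields a zero of \<open>g\<close> left of
  \<open>k\<close>, and monotonicity of \<open>L\<close> makes \<open>g k\<close> positive.
  Conversely the intermediate value theorem gives a zero; it is unique, and \<open>N\<close>
  together with \<open>M N\<close> determines \<open>p\<close> and \<open>q\<close>.\<close>

lemma unique_realisation_iff:
  "(\<exists>!s. case s of (p, q) \<Rightarrow> realises p q) \<longleftrightarrow> h - k \<le> k \<or> g k > 0"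
proof
  assume "\<exists>!s. case s of (p, q) \<Rightarrow> realises p q"
  then obtain p q where "realises p q" by auto
  note zero = zero_if_realises[OF this]
  show "h - k \<le> k \<or> g k > 0"
    using g_k_pos[OF zero(1,3) _ zero(5)] by (cases "h - k \<le> k") auto
next
  assume "h - k \<le> k \<or> g k > 0"
  from exists_zero[OF this] obtain N where N: "0 < N" "N < h - k" "N < k" "g N = 0" by auto
  show "\<exists>!s. case s of (p, q) \<Rightarrow> realises p q"
  proof (rule ex1I)
    show "case ((M N - N) / 2, (M N + N) / 2) of (p, q) \<Rightarrow> realises p q"
      using realises_if_zero[OF N] by simp
  next
    fix s assume "case s of (p, q) \<Rightarrow> realises p q"
    then obtain p q where s: "s = (p, q)" "realises p q" by (cases s) auto
    note zero = zero_if_realises[OF s(2)]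
    have "q - p = N"
      using g_zero_unique[of "q - p" N] zero N by simp
    then have "p + q = M N" using zero by simp
    then have "2 * p = M N - N" "2 * q = M N + N"
      using \<open>q - p = N\<close> by auto
    then have "p = (M N - N) / 2" "q = (M N + N) / 2" by auto
    then show "s = ((M N - N) / 2, (M N + N) / 2)" using s by simp
  qed
qed

text \<open>The difference of the two sides is \<open>4 cos (h/2)\<close> times the bracket
  \<open>W\<close> from \<open>g_k\<close>. For \<open>h - k \<le> k\<close> the angle
  \<open>k - h / 2\<close> is nonnegative, so \<open>W > 0\<close> holds automatically.\<close>

lemma condition_iff:
  "(1 + cos h) * sin (2 * k) > (cos h + cos (2 * k)) * sin h \<longleftrightarrow> h - k \<le> k \<or> g k > 0"
proof -
  define f where "f = h / 2"
  have h: "h = 2 * f" by (simp add: f_def)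
  have f: "0 < f" "f \<le> pi / 4" using k_pos k_less_h h_le by (auto simp: f_def)
  have fpos: "sin f > 0" "cos f > 0" using f by (auto intro!: sin_gt_zero cos_gt_zero)
  have ck: "cos k > 0" using k_pos k_less_h h_le by (intro cos_gt_zero) auto
  define W where "W = cos k * sin (k - f) + sin f ^ 3"
  have "(1 + cos h) * sin (2 * k) - (cos h + cos (2 * k)) * sin h = 4 * cos f * W"
  proof -
    have "cos (2 * f) + cos (2 * k) = 2 * ((cos k)\<^sup>2 - (sin f)\<^sup>2)"
      by (simp add: cos_double_sin[of f] cos_double_cos[of k])
    moreover have "1 + cos (2 * f) = 2 * (cos f)\<^sup>2" by (simp add: cos_double_cos)
    ultimately show ?thesis
      unfolding h W_def
      by (simp only: sin_double sin_diff) (simp add: algebra_simps power2_eq_square power3_eq_cube)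
  qed
  then have "(1 + cos h) * sin (2 * k) > (cos h + cos (2 * k)) * sin h \<longleftrightarrow> 4 * cos f * W > 0"
    by linarith
  also have "\<dots> \<longleftrightarrow> W > 0" using fpos by (simp add: zero_less_mult_iff)
  also have "\<dots> \<longleftrightarrow> h - k \<le> k \<or> g k > 0"
  proof (cases "h - k \<le> k")
    case True
    then have "sin (k - f) \<ge> 0"
      using k_less_h h_le f by (intro sin_ge_zero) (auto simp: h)
    then have "W > 0" unfolding W_def using ck fpos by (simp add: add_nonneg_pos)
    then show ?thesis using True by simp
  next
    case False
    then have "g k = 2 * sin (k + f) * W" using g_k by (simp add: W_def f_def)
    moreover have "sin (k + f) > 0" using f k_pos k_less_h h_le by (intro sin_gt_zero) auto
    ultimately show ?thesis using False by (simp add: zero_less_mult_iff)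
  qed
  finally show ?thesis .
qed

lemma proper_solution_iff_realises:
  assumes "h = pi / real_of_int a" "k = pi / real_of_int b"
  shows "proper_solution a b \<alpha>1 \<alpha>2 \<beta>1 \<beta>2 \<longleftrightarrow>
    (\<exists>p q. realises p q \<and> \<alpha>1 = h - p \<and> \<alpha>2 = 2 * p \<and> \<beta>1 = k - q \<and> \<beta>2 = 2 * q)"
proof
  assume sol: "proper_solution a b \<alpha>1 \<alpha>2 \<beta>1 \<beta>2"
  then have "2 * \<alpha>1 + \<alpha>2 = 2 * h" "2 * \<beta>1 + \<beta>2 = 2 * k"
    by (auto simp: proper_solution_def angle_conditions_def assms)
  then have eqs: "\<alpha>1 = h - \<alpha>2 / 2" "\<beta>1 = k - \<beta>2 / 2" by linarith+
  then have "realises (\<alpha>2 / 2) (\<beta>2 / 2)"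
    using sol by (simp add: realises_def proper_solution_def)
  then show "\<exists>p q. realises p q \<and> \<alpha>1 = h - p \<and> \<alpha>2 = 2 * p \<and> \<beta>1 = k - q \<and> \<beta>2 = 2 * q"
    using eqs by (intro exI[of _ "\<alpha>2 / 2"] exI[of _ "\<beta>2 / 2"]) simp
next
  assume "\<exists>p q. realises p q \<and> \<alpha>1 = h - p \<and> \<alpha>2 = 2 * p \<and> \<beta>1 = k - q \<and> \<beta>2 = 2 * q"
  moreover have "2 * h = 2 * pi / real_of_int a" "2 * k = 2 * pi / real_of_int b"
    using assms by simp_all
  ultimately show "proper_solution a b \<alpha>1 \<alpha>2 \<beta>1 \<beta>2"
    by (auto simp: realises_def proper_solution_def angle_conditions_def)
qed

lemma hyperbolic_iff_unique_realisation:
  assumes "h = pi / real_of_int a" "k = pi / real_of_int b"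
  shows "hyperbolic_vertices_out_of_absolute a b \<longleftrightarrow> (\<exists>!s. case s of (p, q) \<Rightarrow> realises p q)"
proof -
  define F where "F = (\<lambda>(p, q). (h - p, 2 * p, k - q, 2 * q))"
  have inj: "inj F" by (auto simp: inj_def F_def)
  have sol: "(case t of (\<alpha>1, \<alpha>2, \<beta>1, \<beta>2) \<Rightarrow> proper_solution a b \<alpha>1 \<alpha>2 \<beta>1 \<beta>2)
      \<longleftrightarrow> (\<exists>s. t = F s \<and> (case s of (p, q) \<Rightarrow> realises p q))" for t
    by (cases t) (auto simp: proper_solution_iff_realises[OF assms] F_def)
  show ?thesis
    unfolding hyperbolic_vertices_out_of_absolute_def sol by (rule ex1_image_iff[OF inj])
qed

end

theorem theorem1:
  fixes a b :: int
  assumes "a \<ge> 2" and "b > a"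
  shows "hyperbolic_vertices_out_of_absolute a b \<longleftrightarrow>
    (1 + cos (pi / real_of_int a)) * sin (2 * pi / real_of_int b)
      > (cos (pi / real_of_int a) + cos (2 * pi / real_of_int b)) * sin (pi / real_of_int a)"
proof -
  interpret angle_pair "pi / real_of_int a" "pi / real_of_int b"
  proof
    show "0 < pi / real_of_int b" using assms by simp
    show "pi / real_of_int b < pi / real_of_int a"
      using assms by (intro divide_strict_left_mono) auto
    show "pi / real_of_int a = pi / 2 \<and> pi / real_of_int b \<le> pi / 3 \<or> pi / real_of_int a \<le> pi / 3"
    proof (cases "a = 2")
      case True
      then have "pi / real_of_int b \<le> pi / 3" using assms by (intro divide_left_mono) auto
      then show ?thesis using True by simp
    next
      case False
      then have "pi / real_of_int a \<le> pi / 3" using assms by (intro divide_left_mono) auto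
      then show ?thesis by simp
    qed
  qed
  show ?thesis
    using hyperbolic_iff_unique_realisation[OF refl refl] unique_realisation_iff condition_iff
    by simp
qed

end
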